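(* Let $G$ and $G^*$ be finite groups, and let $n\ge 3$ be an odd integer. 1. If $|G|\ge 3$ is odd, then $\{2,\mathsf D(G)\}\in\mathcal L(G)$ if and only if $G$ is isomorphic to the cyclic group $C_{\mathsf D(G)}$ of order $\mathsf D(G)$. 2. If $|G|\ge 3$ is odd and $G^*$ is cyclic such that $\mathcal L(G^* )=\mathcal L(G)$, then $G^*\cong G$. 3. If $G=D_{2n}$ is the dihedral group of order $2n$, then $\{2,\mathsf D(G)\}\in\mathcal L(G)$ and there is an $L\in\mathcal L(G)$ with $\{2,\mathsf D(G)\}\subsetneq L$. 4. If $G^*$ is abelian, then $\mathcal L(G^* )\ne\mathcal L(D_{2n})$.
   Context: Let $G$ be a finite group with identity $1_G$. $\mathcal F(G)$ is the free abelian monoid with basis $G$; its elements are called sequences over $G$ (finite, unordered, repetition allowed), and $|S|$ is the length (number of terms with multiplicity) of $S$. The monoid of product-one sequences $\mathcal B(G)\subset\mathcal F(G)$ consists of all sequences whose terms can be ordered so that their product in $G$ equals $1_G$ (including the empty sequence). $\mathcal A(G)$ denotes the set of atoms (irreducible elements) of $\mathcal B(G)$, and $\mathsf D(G)=\max\{|S|\mid S\in\mathcal A(G)\}$ is the (large) Davenport constant of $G$. For $S\in\mathcal B(G)$ non-empty, $\mathsf L(S)$ is the set of all $k\in\mathbb N$ such that $S$ is a product (in $\mathcal B(G)$) of $k$ atoms; for the empty sequence $\mathsf L=\{0\}$. $\mathcal L(G)=\{\mathsf L(S)\mid S\in\mathcal B(G)\}$ is the system of sets of lengths. *)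

theory Defs
  imports "HOL-Algebra.Elementary_Groups" "HOL-Algebra.Divisibility" "HOL-Library.Multiset"
begin

section \<open>Product-one sequences\<close>

text \<open>
  The free abelian monoid over (the carrier of) a group is rendered by finite multisets, with
  multiset sum as monoid operation and \<open>size\<close> as length.
\<close>

definition product_one_sequences :: "('a, 'm) monoid_scheme \<Rightarrow> 'a multiset set" where
  "product_one_sequences G =
    {S. set_mset S \<subseteq> carrier G \<and> (\<exists>xs. mset xs = S \<and> foldr (\<otimes>\<^bsub>G\<^esub>) xs \<one>\<^bsub>G\<^esub> = \<one>\<^bsub>G\<^esub>)}"

definition product_one_monoid :: "('a, 'm) monoid_scheme \<Rightarrow> 'a multiset monoid" where
  "product_one_monoid G =
    \<lparr>carrier = product_one_sequences G, monoid.mult = (+), one = {#}\<rparr>"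

text \<open>
  Irreducibility is taken inside the monoid of product-one sequences: the cofactors in the
  divisibility relation have to be product-one sequences themselves.
\<close>

definition atoms :: "('a, 'm) monoid_scheme \<Rightarrow> 'a multiset set" where
  "atoms G = {A \<in> product_one_sequences G. irreducible (product_one_monoid G) A}"

text \<open>The maximum exists for finite groups, see \<open>finite_atoms\<close> and \<open>atoms_nonempty\<close> below.\<close>

definition davenport :: "('a, 'm) monoid_scheme \<Rightarrow> nat" where
  "davenport G = Max (size ` atoms G)"

text \<open>
  The empty sequence has the empty factorization only, hence the set of lengths \<open>{0}\<close>, see
  \<open>lengths_empty\<close> below.
\<close>

definition lengths :: "('a, 'm) monoid_scheme \<Rightarrow> 'a multiset \<Rightarrow> nat set" where
  "lengths G S = {k. \<exists>F. size F = k \<and> set_mset F \<subseteq> atoms G \<and> sum_mset F = S}"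

definition system_of_lengths :: "('a, 'm) monoid_scheme \<Rightarrow> nat set set" where
  "system_of_lengths G = lengths G ` product_one_sequences G"


section \<open>Dihedral groups\<close>

text \<open>
  For \<open>n > 0\<close> this is the dihedral group of order \<open>2 * n\<close>: the pair \<open>(i, s)\<close> stands for \<open>a\<^sup>i\<close>
  if \<open>s\<close> is false and for \<open>a\<^sup>i b\<close> if \<open>s\<close> is true, where \<open>a\<close> has order \<open>n\<close>, \<open>b\<close> has order 2 and
  \<open>b a b = a\<^sup>-\<^sup>1\<close>.
\<close>

definition dihedral_group :: "nat \<Rightarrow> (int \<times> bool) monoid" where
  "dihedral_group n =
    \<lparr>carrier = carrier (integer_mod_group n) \<times> UNIV,
     monoid.mult = (\<lambda>(i, s) (j, t). ((if s then i - j else i + j) mod int n, s \<noteq> t)),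
     one = (0, False)\<rparr>"


section \<open>Basic properties\<close>

lemma group_dihedral_group:
  assumes "n > 0"
  shows "group (dihedral_group n)"
proof (rule groupI)
  fix x assume "x \<in> carrier (dihedral_group n)"
  then obtain i s where x: "x = (i, s)" "0 \<le> i" "i < int n"
    using assms by (auto simp: dihedral_group_def carrier_integer_mod_group)
  have "(if s then x else ((- i) mod int n, False)) \<in> carrier (dihedral_group n)"
    using assms x by (auto simp: dihedral_group_def carrier_integer_mod_group)
  moreover have "(if s then x else ((- i) mod int n, False)) \<otimes>\<^bsub>dihedral_group n\<^esub> x
    = \<one>\<^bsub>dihedral_group n\<^esub>"
    using x by (auto simp: dihedral_group_def mod_simps)
  ultimately show "\<exists>y\<in>carrier (dihedral_group n). y \<otimes>\<^bsub>dihedral_group n\<^esub> x = \<one>\<^bsub>dihedral_group n\<^esub>"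
    by blast
next
  fix x y z :: "int \<times> bool"
  obtain i s j t k u where "x = (i, s)" "y = (j, t)" "z = (k, u)"
    by (metis surj_pair)
  then show "x \<otimes>\<^bsub>dihedral_group n\<^esub> y \<otimes>\<^bsub>dihedral_group n\<^esub> z
    = x \<otimes>\<^bsub>dihedral_group n\<^esub> (y \<otimes>\<^bsub>dihedral_group n\<^esub> z)"
    by (cases s; cases t) (simp_all add: dihedral_group_def mod_simps, simp_all add: algebra_simps)
qed (use assms in \<open>auto simp: dihedral_group_def carrier_integer_mod_group\<close>)

lemma order_dihedral_group: "n > 0 \<Longrightarrow> order (dihedral_group n) = 2 * n"
  by (simp add: order_def dihedral_group_def carrier_integer_mod_group card_cartesian_product)

lemma (in group) foldr_append_mult:
  assumes "set xs \<subseteq> carrier G" "set ys \<subseteq> carrier G"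
  shows "foldr (\<otimes>) (xs @ ys) \<one> = foldr (\<otimes>) xs \<one> \<otimes> foldr (\<otimes>) ys \<one>"
  using assms(1)
proof (induction xs)
  case Nil
  show ?case using multlist_closed[OF assms(2)] by simp
next
  case (Cons x xs)
  then show ?case
    using multlist_closed[OF assms(2)] multlist_closed[of xs] by (simp add: m_assoc)
qed

lemma (in group) comm_monoid_cancel_product_one_monoid:
  "comm_monoid_cancel (product_one_monoid G)"
proof (rule comm_monoid_cancelI)
  show "comm_monoid (product_one_monoid G)"
  proof (rule comm_monoidI)
    fix S T
    assume "S \<in> carrier (product_one_monoid G)" "T \<in> carrier (product_one_monoid G)"
    then obtain xs ys where *: "mset xs = S" "mset ys = T" "set xs \<subseteq> carrier G"
      "set ys \<subseteq> carrier G" "foldr (\<otimes>) xs \<one> = \<one>" "foldr (\<otimes>) ys \<one> = \<one>"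
      by (auto simp: product_one_monoid_def product_one_sequences_def)
    have "mset (xs @ ys) = S + T \<and> foldr (\<otimes>) (xs @ ys) \<one> = \<one>"
      using * foldr_append_mult[of xs ys] by (simp del: foldr_append)
    then have "\<exists>zs. mset zs = S + T \<and> foldr (\<otimes>) zs \<one> = \<one>" by blast
    moreover have "set_mset (S + T) \<subseteq> carrier G" using * by auto
    ultimately show "S \<otimes>\<^bsub>product_one_monoid G\<^esub> T \<in> carrier (product_one_monoid G)"
      by (simp add: product_one_monoid_def product_one_sequences_def)
  qed (auto simp: product_one_monoid_def product_one_sequences_def ac_simps)
qed (auto simp: product_one_monoid_def)

lemma carrier_product_one_monoid [simp]:
  "carrier (product_one_monoid G) = product_one_sequences G"
  by (simp add: product_one_monoid_def)

lemma Units_product_one_monoid: "Units (product_one_monoid G) = {{#}}"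
  by (auto simp: Units_def product_one_monoid_def product_one_sequences_def)

lemma empty_notin_atoms: "{#} \<notin> atoms G"
  by (auto simp: atoms_def irreducible_def Units_product_one_monoid)

lemma atoms_iff:
  "A \<in> atoms G \<longleftrightarrow> A \<in> product_one_sequences G \<and> A \<noteq> {#} \<and>
    (\<forall>S\<in>product_one_sequences G. \<forall>T\<in>product_one_sequences G. A = S + T \<longrightarrow> S = {#} \<or> T = {#})"
  (is "?L \<longleftrightarrow> ?R")
proof
  assume L: ?L
  have "S = {#} \<or> T = {#}"
    if "S \<in> product_one_sequences G" "T \<in> product_one_sequences G" "A = S + T" for S T
  proof (rule ccontr)
    assume ne: "\<not> (S = {#} \<or> T = {#})"
    have "properfactor (product_one_monoid G) S A"
      using that ne by (auto simp: properfactor_def factor_def product_one_monoid_def)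
    with L ne that(1) show False
      by (auto simp: atoms_def irreducible_def Units_product_one_monoid)
  qed
  with L show ?R
    by (auto simp: atoms_def irreducible_def Units_product_one_monoid)
next
  assume R: ?R
  have "S = {#}" if S: "S \<in> product_one_sequences G"
    and pf: "properfactor (product_one_monoid G) S A" for S
  proof -
    obtain T where T: "T \<in> product_one_sequences G" "A = S + T"
      using pf by (auto simp: properfactor_def factor_def product_one_monoid_def)
    have "T \<noteq> {#}"
      using pf T by (auto simp: properfactor_def factor_def product_one_monoid_def)
    with R S T show ?thesis by blast
  qed
  with R show ?L
    by (auto simp: atoms_def irreducible_def Units_product_one_monoid)
qed

lemma lengths_empty: "lengths G {#} = {0}"
proof -
  have "F = {#}" if "set_mset F \<subseteq> atoms G" "sum_mset F = {#}" for F
    using that empty_notin_atoms by (cases F) auto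
  then show ?thesis by (force simp: lengths_def)
qed

lemma (in group) atoms_nonempty: "{#\<one>#} \<in> atoms G"
proof -
  have "mset [\<one>] = {#\<one>#} \<and> foldr (\<otimes>) [\<one>] \<one> = \<one>" by simp
  then have "{#\<one>#} \<in> product_one_sequences G"
    unfolding product_one_sequences_def by (auto intro!: exI[of _ "[\<one>]"])
  moreover have "S = {#} \<or> T = {#}" if "{#\<one>#} = S + T" for S T
    using that by (metis add_is_1 size_eq_0_iff_empty size_single size_union One_nat_def)
  ultimately show ?thesis by (auto simp: atoms_iff)
qed

lemma (in group) size_atom_le:
  assumes "finite (carrier G)" "A \<in> atoms G"
  shows "size A \<le> order G"
proof (rule ccontr)
  assume big: "\<not> size A \<le> order G"
  obtain xs where xs: "mset xs = A" "set xs \<subseteq> carrier G" "foldr (\<otimes>) xs \<one> = \<one>"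
    using assms(2) by (auto simp: atoms_iff product_one_sequences_def)
  define p where "p k = foldr (\<otimes>) (take k xs) \<one>" for k
  have sub: "set (take k xs) \<subseteq> carrier G" "set (drop k xs) \<subseteq> carrier G" for k
    using xs(2) set_take_subset set_drop_subset by (metis subset_trans)+
  have "p ` {1..size A} \<subseteq> carrier G"
    using multlist_closed[OF sub(1)] by (auto simp: p_def)
  then have "card (p ` {1..size A}) < card {1..size A}"
    using big card_mono[OF assms(1), of "p ` {1..size A}"] by (simp add: order_def)
  then have "\<not> inj_on p {1..size A}"
    using pigeonhole by blast
  then obtain i j where ij: "1 \<le> i" "i < j" "j \<le> size A" "p i = p j"
    unfolding inj_on_def by (metis atLeastAtMost_iff nat_neq_iff)
  define ys where "ys = drop i (take j xs)"
  define zs where "zs = take i xs @ drop j xs"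
  have tj: "take j xs = take i xs @ ys"
    using ij by (metis ys_def append_take_drop_id min.absorb1 less_imp_le take_take)
  have ys: "set ys \<subseteq> carrier G" using sub(1)[of j] tj by auto
  have "p i \<otimes> foldr (\<otimes>) ys \<one> = p i"
    using foldr_append_mult[OF sub(1)[of i] ys] tj ij by (simp add: p_def del: foldr_append)
  then have y1: "foldr (\<otimes>) ys \<one> = \<one>"
    using multlist_closed[OF ys] multlist_closed[OF sub(1)[of i]]
    by (simp add: p_def)
  have "foldr (\<otimes>) zs \<one> = p j \<otimes> foldr (\<otimes>) (drop j xs) \<one>"
    using foldr_append_mult[OF sub(1)[of i] sub(2)[of j]] ij
    by (simp add: zs_def p_def del: foldr_append)
  also have "\<dots> = foldr (\<otimes>) (take j xs @ drop j xs) \<one>"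
    using foldr_append_mult[OF sub(1)[of j] sub(2)[of j]] by (simp add: p_def)
  finally have z1: "foldr (\<otimes>) zs \<one> = \<one>" using xs(3) by simp
  have zs: "set zs \<subseteq> carrier G" using sub by (simp add: zs_def)
  have "mset xs = mset ys + mset zs"
    using arg_cong[OF append_take_drop_id[of j xs], of mset] by (simp add: tj zs_def ac_simps)
  moreover have "mset ys \<in> product_one_sequences G" "mset zs \<in> product_one_sequences G"
    using ys y1 z1 zs unfolding product_one_sequences_def by auto
  moreover have "length xs = size A" using xs(1) by auto
  moreover from this have "ys \<noteq> []" "zs \<noteq> []"
    using ij by (auto simp: ys_def zs_def)
  ultimately show False
    using assms(2) xs(1) by (auto simp: atoms_iff)
qed

lemma (in group) finite_atoms:
  assumes "finite (carrier G)"
  shows "finite (atoms G)"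
proof (rule finite_subset)
  show "atoms G \<subseteq> mset ` {xs. set xs \<subseteq> carrier G \<and> length xs \<le> order G}"
  proof
    fix A assume A: "A \<in> atoms G"
    obtain xs where "mset xs = A" using ex_mset by blast
    with A size_atom_le[OF assms A]
    show "A \<in> mset ` {xs. set xs \<subseteq> carrier G \<and> length xs \<le> order G}"
      by (intro image_eqI[of _ _ xs]) (auto simp: atoms_def product_one_sequences_def)
  qed
  show "finite (mset ` {xs. set xs \<subseteq> carrier G \<and> length xs \<le> order G})"
    using finite_lists_length_le[OF assms] by simp
qed

end

(*
  If L(S) contains 2 and D = D(G) >= 3, then S is a product of two atoms of length D and also of D
  pairs x, x^-1. If moreover L(S) = {2, D}, then every sequence V that takes one term of each pair
  and contains no pair itself is minimal: an atom W inside V yields a factorization of S into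
  2 + (D - |W|) atoms. For |G| odd such a V exists. Since no atom is longer than V, all orderings of
  V have product one, so the terms of V commute; as they generate G, the group is abelian. In an
  abelian group, replacing all copies of a term g of V by g^-1 shows that V = g^D, unless G is an
  elementary 2-group; in both cases {2, D} is the only set of lengths containing 2 and D. In the
  dihedral group, (ab)^n b^n times its inverse has set of lengths {2, 2n}, whereas a^(2n-2) b^2 times
  its inverse also has a factorization of length n + 2. Finally D is determined by the system of
  sets of lengths, as the maximal k that occurs together with 2.
*)

theory Submission
  imports Defs "HOL-Algebra.Multiplicative_Group"
begin

section \<open>Product-one sequences and atoms\<close>

text \<open>Most existence steps rest on one principle: a sequence of length D(G) over G contains a
  nonempty product-one subsequence, for otherwise appending the inverse of the product of some
  ordering would give an atom of length D(G) + 1. This shows that V is product-one at all and, after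
  one term of V is exchanged for an arbitrary group element, that V generates G. The obstacle is
  that a product-one subsequence W of V need not split off when G is not abelian. Passing to S = V +
  inv V avoids this: W and inv W are two atoms, and the remaining terms of S fall into pairs
  whatever the complement of W in V is. Oddness of |G| ensures that no term of S is its own inverse,
  so that a half without pairs exists. Oddness of n works through parity: the signed sums of zeros
  and ones that decide membership in the dihedral case keep their parity under reordering, and an
  odd multiple of n has absolute value at least n. The bound D(G) >= 3 separates the lengths 2 and
  D(G) and makes pairs shorter than the longest atoms.\<close>

lemma add_mset_eq_union_subseteq:
  assumes "add_mset z T = U + V"
  shows "U \<subseteq># T \<or> V \<subseteq># T"
proof -
  have "z \<in># U + V" using assms by (metis union_single_eq_member add_mset_add_single union_commute)
  then consider "z \<in># U" | "z \<in># V" by auto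
  then show ?thesis
  proof cases
    case 1
    then obtain U' where "U = add_mset z U'" by (blast dest: multi_member_split)
    then have "T = U' + V" using assms by simp
    then show ?thesis by simp
  next
    case 2
    then obtain V' where "V = add_mset z V'" by (blast dest: multi_member_split)
    then have "T = U + V'" using assms by simp
    then show ?thesis by simp
  qed
qed

context group
begin

abbreviation inv_seq :: "'a multiset \<Rightarrow> 'a multiset"
  where "inv_seq S \<equiv> image_mset (m_inv G) S"

lemma product_one_sequencesI:
  "set xs \<subseteq> carrier G \<Longrightarrow> foldr (\<otimes>) xs \<one> = \<one> \<Longrightarrow> mset xs \<in> product_one_sequences G"
  by (auto simp: product_one_sequences_def)

lemma product_one_sequencesE:
  assumes "S \<in> product_one_sequences G"
  obtains xs where "mset xs = S" "set xs \<subseteq> carrier G" "foldr (\<otimes>) xs \<one> = \<one>"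
  using assms by (auto simp: product_one_sequences_def)

lemma empty_product_one: "{#} \<in> product_one_sequences G"
  using product_one_sequencesI[of "[]"] by simp

lemma product_one_add:
  assumes "S \<in> product_one_sequences G" "T \<in> product_one_sequences G"
  shows "S + T \<in> product_one_sequences G"
proof -
  obtain xs where xs: "mset xs = S" "set xs \<subseteq> carrier G" "foldr (\<otimes>) xs \<one> = \<one>"
    using assms(1) by (rule product_one_sequencesE)
  obtain ys where ys: "mset ys = T" "set ys \<subseteq> carrier G" "foldr (\<otimes>) ys \<one> = \<one>"
    using assms(2) by (rule product_one_sequencesE)
  have "mset (xs @ ys) \<in> product_one_sequences G"
    using xs ys foldr_append_mult[of xs ys]
    by (intro product_one_sequencesI) (auto simp del: foldr_append)
  with xs ys show ?thesis by simp
qed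

lemma product_one_sum:
  "set_mset F \<subseteq> product_one_sequences G \<Longrightarrow> sum_mset F \<in> product_one_sequences G"
  by (induction F) (auto intro: empty_product_one product_one_add)

lemma atom_product_one: "A \<in> atoms G \<Longrightarrow> A \<in> product_one_sequences G"
  by (simp add: atoms_def)

lemma product_one_carrier: "S \<in> product_one_sequences G \<Longrightarrow> set_mset S \<subseteq> carrier G"
  by (simp add: product_one_sequences_def)

text \<open>Because of the reversal, inverting all terms preserves product-one sequences over
  non-abelian groups too.\<close>

lemma foldr_rev_inv:
  "set xs \<subseteq> carrier G \<Longrightarrow> foldr (\<otimes>) (rev (map (m_inv G) xs)) \<one> = inv (foldr (\<otimes>) xs \<one>)"
proof (induction xs)
  case (Cons x xs)
  have "set (rev (map (m_inv G) xs)) \<subseteq> carrier G" "set [inv x] \<subseteq> carrier G"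
    using Cons.prems by auto
  from foldr_append_mult[OF this] show ?case
    using Cons multlist_closed[of xs] by (simp add: inv_mult_group del: foldr_append)
qed simp

lemma inv_seq_inv_seq: "set_mset S \<subseteq> carrier G \<Longrightarrow> inv_seq (inv_seq S) = S"
  by (induction S) auto

lemma count_inv_seq:
  assumes "set_mset S \<subseteq> carrier G" "x \<in> carrier G"
  shows "count (inv_seq S) x = count S (inv x)"
  using assms(1)
proof (induction S)
  case (add y S)
  then have "inv y = x \<longleftrightarrow> y = inv x" using assms(2) by auto
  with add show ?case by simp
qed simp

lemma product_one_inv_seq:
  assumes "S \<in> product_one_sequences G"
  shows "inv_seq S \<in> product_one_sequences G"
proof -
  obtain xs where xs: "mset xs = S" "set xs \<subseteq> carrier G" "foldr (\<otimes>) xs \<one> = \<one>"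
    using assms by (rule product_one_sequencesE)
  have "mset (rev (map (m_inv G) xs)) \<in> product_one_sequences G"
    using xs(2,3) foldr_rev_inv[OF xs(2)] by (intro product_one_sequencesI) auto
  with xs(1) show ?thesis by simp
qed

lemma atom_inv_seq:
  assumes "A \<in> atoms G"
  shows "inv_seq A \<in> atoms G"
proof -
  have A: "A \<in> product_one_sequences G" using assms by (rule atom_product_one)
  have "S = {#} \<or> T = {#}" if "S \<in> product_one_sequences G" "T \<in> product_one_sequences G"
    "inv_seq A = S + T" for S T
  proof -
    have "A = inv_seq S + inv_seq T"
      using that(3) inv_seq_inv_seq[OF product_one_carrier[OF A]] by (metis image_mset_union)
    moreover have "inv_seq S \<in> product_one_sequences G" "inv_seq T \<in> product_one_sequences G"
      using that(1,2) by (simp_all only: product_one_inv_seq)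
    ultimately have "inv_seq S = {#} \<or> inv_seq T = {#}"
      using assms unfolding atoms_iff by blast
    then show ?thesis by simp
  qed
  with A assms show ?thesis by (auto simp: atoms_iff product_one_inv_seq)
qed

lemma product_one_single: "{#x#} \<in> product_one_sequences G \<longleftrightarrow> x = \<one>"
proof
  assume "{#x#} \<in> product_one_sequences G"
  then obtain xs where "mset xs = {#x#}" "set xs \<subseteq> carrier G" "foldr (\<otimes>) xs \<one> = \<one>"
    by (rule product_one_sequencesE)
  then show "x = \<one>" by auto
next
  assume "x = \<one>"
  then show "{#x#} \<in> product_one_sequences G" using atoms_nonempty atom_product_one by simp
qed

lemma product_one_pair: "x \<in> carrier G \<Longrightarrow> {#x, inv x#} \<in> product_one_sequences G"
  using product_one_sequencesI[of "[x, inv x]"] by simp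

text \<open>A proper splitting would consist of two single terms, and only \<open>\<one>\<close> is
  product-one on its own. An involution is allowed and gives a pair of equal terms.\<close>

lemma atom_pair:
  assumes "x \<in> carrier G" "x \<noteq> \<one>"
  shows "{#x, inv x#} \<in> atoms G"
proof -
  have "S = {#} \<or> T = {#}" if "S \<in> product_one_sequences G" "T \<in> product_one_sequences G"
    "{#x, inv x#} = S + T" for S T
  proof (rule ccontr)
    assume ne: "\<not> (S = {#} \<or> T = {#})"
    have "size S + size T = 2" using arg_cong[OF that(3), of size] by simp
    moreover have "size S > 0" "size T > 0" using ne by (simp_all add: nonempty_has_size)
    ultimately have "size S = 1" by linarith
    then obtain y where y: "S = {#y#}" by (metis size_1_singleton_mset)
    then have "y = \<one>" using that(1) product_one_single by simp
    moreover have "y = x \<or> y = inv x"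
      using arg_cong[OF that(3), of "\<lambda>M. y \<in># M"] y by auto
    ultimately show False using assms inv_eq_1_iff by metis
  qed
  then show ?thesis using assms product_one_pair by (auto simp: atoms_iff)
qed

text \<open>Deleting \<open>\<one>\<close> from an ordering keeps its product, so the rest is again
  product-one, and irreducibility makes it empty.\<close>

lemma atom_one:
  assumes "A \<in> atoms G" "\<one> \<in># A"
  shows "A = {#\<one>#}"
proof -
  obtain xs where xs: "mset xs = A" "set xs \<subseteq> carrier G" "foldr (\<otimes>) xs \<one> = \<one>"
    using atom_product_one[OF assms(1)] by (rule product_one_sequencesE)
  then obtain ys zs where yz: "xs = ys @ \<one> # zs" using assms(2) by (metis split_list set_mset_mset)
  have c: "set ys \<subseteq> carrier G" "set zs \<subseteq> carrier G" "set (\<one> # zs) \<subseteq> carrier G"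
    using xs(2) yz by auto
  have "foldr (\<otimes>) (ys @ zs) \<one> = foldr (\<otimes>) (ys @ \<one> # zs) \<one>"
    using foldr_append_mult[OF c(1,2)] foldr_append_mult[OF c(1,3)] multlist_closed[OF c(2)]
    by (simp del: foldr_append)
  then have "mset (ys @ zs) \<in> product_one_sequences G"
    using xs(3) yz c by (intro product_one_sequencesI) auto
  moreover have "A = {#\<one>#} + mset (ys @ zs)" using xs(1) yz by simp
  ultimately have "mset (ys @ zs) = {#}"
    using assms(1) product_one_single[of \<one>] unfolding atoms_iff
    by (metis empty_not_add_mset)
  then show ?thesis using \<open>A = {#\<one>#} + mset (ys @ zs)\<close> by simp
qed

lemma atom_size_ge_2:
  assumes "A \<in> atoms G" "\<one> \<notin># A"
  shows "size A \<ge> 2"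
proof (rule ccontr)
  assume "\<not> size A \<ge> 2"
  moreover have "size A > 0" using assms(1) empty_notin_atoms by (metis nonempty_has_size)
  ultimately have "size A = 1" by linarith
  then obtain x where "A = {#x#}" by (metis size_1_singleton_mset)
  with assms atom_product_one[of A] show False by (auto simp: product_one_single)
qed

lemma product_one_size_2:
  assumes "A \<in> product_one_sequences G" "size A = 2"
  obtains x where "x \<in> carrier G" "A = {#x, inv x#}"
proof -
  obtain xs where xs: "mset xs = A" "set xs \<subseteq> carrier G" "foldr (\<otimes>) xs \<one> = \<one>"
    using assms(1) by (rule product_one_sequencesE)
  then have "length xs = 2" using assms(2) by (metis size_mset)
  then obtain x y where "xs = [x, y]"
    by (auto simp: numeral_2_eq_2 length_Suc_conv)
  with xs have xy: "x \<in> carrier G" "y \<in> carrier G" "x \<otimes> y = \<one>" "A = {#x, y#}" by auto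
  then have "y = inv x" using inv_equality[of x y] by auto
  with xy that show thesis by blast
qed

lemma exists_atom_subseteq:
  assumes "S \<in> product_one_sequences G" "S \<noteq> {#}"
  obtains A where "A \<in> atoms G" "A \<subseteq># S"
proof -
  have "\<exists>A\<in>atoms G. A \<subseteq># S" using assms
  proof (induction "size S" arbitrary: S rule: less_induct)
    case less
    show ?case
    proof (cases "S \<in> atoms G")
      case False
      then obtain T U where TU: "T \<in> product_one_sequences G" "S = T + U" "T \<noteq> {#}" "U \<noteq> {#}"
        using less.prems by (auto simp: atoms_iff)
      have "size T < size S" using TU by (simp add: nonempty_has_size)
      from less.hyps[OF this TU(1,3)] TU(2) show ?thesis
        by (metis mset_subset_eq_add_left subset_mset.order_trans)
    qed auto
  qed
  with that show thesis by blast
qed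

lemma size_atom_le_davenport:
  assumes "finite (carrier G)" "A \<in> atoms G"
  shows "size A \<le> davenport G"
  using finite_atoms[OF assms(1)] assms(2) by (simp add: davenport_def)

lemma exists_atom_size_davenport:
  assumes "finite (carrier G)"
  obtains A where "A \<in> atoms G" "size A = davenport G"
proof -
  have "davenport G \<in> size ` atoms G"
    unfolding davenport_def using finite_atoms[OF assms] atoms_nonempty by (intro Max_in) auto
  with that show thesis by auto
qed

lemma davenport_le_order:
  assumes "finite (carrier G)"
  shows "davenport G \<le> order G"
  using exists_atom_size_davenport[OF assms] size_atom_le[OF assms] by metis

text \<open>If the inverse \<open>z\<close> of the product of an ordering is appended, any splitting
  of the result has a factor inside \<open>T\<close>, which is then empty; so the result is an atom.
  The contrapositive is the main use: every sequence of length D(G) contains a nonempty product-one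
  subsequence.\<close>

lemma product_one_free_size:
  assumes "finite (carrier G)" "set_mset T \<subseteq> carrier G"
    and free: "\<And>W. W \<in> product_one_sequences G \<Longrightarrow> W \<subseteq># T \<Longrightarrow> W = {#}"
  shows "size T < davenport G"
proof -
  obtain xs where xs: "mset xs = T" using ex_mset by blast
  define z where "z = inv (foldr (\<otimes>) xs \<one>)"
  have c: "foldr (\<otimes>) xs \<one> \<in> carrier G" using xs assms(2) by (intro multlist_closed) auto
  have "mset (z # xs) \<in> product_one_sequences G"
    using xs assms(2) c by (intro product_one_sequencesI) (auto simp: z_def)
  moreover have "U = {#} \<or> V = {#}" if "U \<in> product_one_sequences G"
    "V \<in> product_one_sequences G" "add_mset z T = U + V" for U V
  proof -
    have "U \<subseteq># T \<or> V \<subseteq># T"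
      using that(3) by (rule add_mset_eq_union_subseteq)
    with free that show ?thesis by blast
  qed
  ultimately have "add_mset z T \<in> atoms G" using xs by (auto simp: atoms_iff)
  from size_atom_le_davenport[OF assms(1) this] show ?thesis by simp
qed

end

section \<open>Sets of lengths containing 2\<close>

context group
begin

lemma lengths_add:
  assumes "k \<in> lengths G S" "l \<in> lengths G T"
  shows "k + l \<in> lengths G (S + T)"
proof -
  obtain E F where "size E = k" "set_mset E \<subseteq> atoms G" "sum_mset E = S"
    "size F = l" "set_mset F \<subseteq> atoms G" "sum_mset F = T"
    using assms by (auto simp: lengths_def)
  then show ?thesis by (auto simp: lengths_def intro!: exI[of _ "E + F"])
qed

lemma lengths_atom: "A \<in> atoms G \<Longrightarrow> 1 \<in> lengths G A"
  by (auto simp: lengths_def intro!: exI[of _ "{#A#}"])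

lemma two_in_lengths_iff: "2 \<in> lengths G S \<longleftrightarrow> (\<exists>A\<in>atoms G. \<exists>B\<in>atoms G. S = A + B)"
proof
  assume "2 \<in> lengths G S"
  then obtain F where F: "size F = 2" "set_mset F \<subseteq> atoms G" "sum_mset F = S"
    by (auto simp: lengths_def)
  then obtain A F' where F': "F = add_mset A F'" "size F' = 1"
    by (metis Suc_1 size_Suc_Diff1 size_eq_Suc_imp_eq_union size_add_mset nat.inject One_nat_def)
  then obtain B where "F' = {#B#}" by (metis size_1_singleton_mset)
  with F F' show "\<exists>A\<in>atoms G. \<exists>B\<in>atoms G. S = A + B" by auto
next
  assume "\<exists>A\<in>atoms G. \<exists>B\<in>atoms G. S = A + B"
  then show "2 \<in> lengths G S"
    using lengths_add[OF lengths_atom lengths_atom] by (auto simp flip: one_add_one)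
qed

text \<open>Used to force remainders: once one of the two atoms of \<open>A + B\<close> occurs in a
  factorization, what is left factors the other one.\<close>

lemma atom_factorization:
  assumes "B \<in> atoms G" "set_mset F \<subseteq> atoms G" "sum_mset F = B"
  shows "F = {#B#}"
proof -
  have "F \<noteq> {#}" using assms(1,3) by (auto simp: empty_notin_atoms)
  then obtain X F' where F: "F = add_mset X F'" by (metis multiset_cases)
  have "sum_mset F' \<in> product_one_sequences G"
    using assms(2) F by (intro product_one_sum) (auto simp: atom_product_one)
  moreover have "X \<in> product_one_sequences G" "X \<noteq> {#}"
    using assms(2) F atom_product_one empty_notin_atoms by auto
  moreover have "B = X + sum_mset F'" using assms(3) F by simp
  ultimately have "sum_mset F' = {#}" using assms(1) unfolding atoms_iff by blast
  then have "F' = {#}" using assms(2) F empty_notin_atoms by (cases F') auto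
  with F assms(3) show ?thesis by simp
qed

text \<open>Away from \<open>\<one>\<close> atoms have length at least 2. The equality case is what
  turns a factorization of length D(G) into a splitting into pairs.\<close>

lemma size_sum_atoms:
  assumes "set_mset F \<subseteq> atoms G" "\<one> \<notin># sum_mset F"
  shows "2 * size F \<le> size (sum_mset F) \<and>
    (size (sum_mset F) = 2 * size F \<longrightarrow> (\<forall>A\<in>#F. size A = 2))"
  using assms
proof (induction F)
  case (add A F)
  then have "size A \<ge> 2" by (intro atom_size_ge_2) auto
  with add show ?case by auto
qed simp

lemma pairs_in_lengths:
  assumes "set_mset V \<subseteq> carrier G" "\<one> \<notin># V"
  shows "size V \<in> lengths G (V + inv_seq V)"
  using assms
proof (induction V)
  case empty
  show ?case by (simp add: lengths_empty)
next
  case (add x V)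
  then have "size V + 1 \<in> lengths G ((V + inv_seq V) + {#x, inv x#})"
    by (intro lengths_add lengths_atom atom_pair) auto
  moreover have "(V + inv_seq V) + {#x, inv x#} = add_mset x V + inv_seq (add_mset x V)" by simp
  ultimately show ?case by (metis size_add_mset Suc_eq_plus1)
qed

lemma one_notin_atom: "A \<in> atoms G \<Longrightarrow> size A \<ge> 2 \<Longrightarrow> \<one> \<notin># A"
  using atom_one by fastforce

lemma two_davenport_in_lengths:
  assumes "A \<in> atoms G" "size A \<ge> 2"
  shows "{2, size A} \<subseteq> lengths G (A + inv_seq A)"
proof -
  have "2 \<in> lengths G (A + inv_seq A)"
    using assms atom_inv_seq unfolding two_in_lengths_iff by blast
  moreover have "size A \<in> lengths G (A + inv_seq A)"
    using assms one_notin_atom[OF assms] product_one_carrier[OF atom_product_one]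
    by (intro pairs_in_lengths) auto
  ultimately show ?thesis by simp
qed

text \<open>By \<open>atom_one\<close>, both the product of two atoms and the given factorization
  contain the atom \<open>{#\<one>#}\<close>. Cancelling it leaves a single atom \<open>C\<close>,
  which factors in only one way.\<close>

lemma lengths_with_two_and_one:
  assumes "2 \<in> lengths G S" "\<one> \<in># S" "k \<in> lengths G S"
  shows "k = 2"
proof -
  obtain A B where AB: "A \<in> atoms G" "B \<in> atoms G" "S = A + B"
    using assms(1) by (auto simp: two_in_lengths_iff)
  obtain F where F: "size F = k" "set_mset F \<subseteq> atoms G" "sum_mset F = S"
    using assms(3) by (auto simp: lengths_def)
  obtain C where C: "C \<in> atoms G" "S = {#\<one>#} + C"
  proof (cases "\<one> \<in># A")
    case True
    with AB atom_one that show thesis by blast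
  next
    case False
    with assms(2) AB have "B = {#\<one>#}" by (intro atom_one) auto
    with AB that[of A] show thesis by simp
  qed
  obtain X where "X \<in># F" "\<one> \<in># X" using assms(2) F(3) by (auto simp: in_Union_mset_iff)
  then have "{#\<one>#} \<in># F" using F(2) atom_one by (metis subsetD)
  then obtain F' where F': "F = add_mset {#\<one>#} F'" by (metis multi_member_split)
  have "F' = {#C#}" using F F' C by (intro atom_factorization) auto
  with F F' show ?thesis by auto
qed

text \<open>The value 2 covers sequences containing \<open>\<one>\<close>. It matters for the
  trivial group, where D(G) = 1 and two copies of \<open>\<one>\<close> have set of lengths
  {2}.\<close>

lemma lengths_with_two_le:
  assumes "finite (carrier G)" "2 \<in> lengths G S" "k \<in> lengths G S"
  shows "k \<le> max 2 (davenport G)"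
proof (cases "\<one> \<in># S")
  case False
  obtain A B where AB: "A \<in> atoms G" "B \<in> atoms G" "S = A + B"
    using assms(2) by (auto simp: two_in_lengths_iff)
  obtain F where F: "size F = k" "set_mset F \<subseteq> atoms G" "sum_mset F = S"
    using assms(3) by (auto simp: lengths_def)
  have "2 * k \<le> size S" using size_sum_atoms[OF F(2)] F(1,3) False by simp
  moreover have "size S = size A + size B" using AB(3) by simp
  moreover have "size A \<le> davenport G" "size B \<le> davenport G"
    using AB size_atom_le_davenport[OF assms(1)] by auto
  ultimately show ?thesis by simp
next
  case True
  then show ?thesis using lengths_with_two_and_one[OF assms(2) _ assms(3)] by simp
qed

text \<open>A factorization that uses \<open>V\<close> or its inverse has exactly one further atom.
  Any other factorization consists of atoms of length 2, so comparing sizes fixes its length. Both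
  the abelian and the dihedral computations of {2, D(G)} go through this criterion.\<close>

lemma lengths_atom_inverse:
  assumes V: "V \<in> atoms G" "size V \<ge> 2"
    and atoms: "\<And>A. A \<in> atoms G \<Longrightarrow> A \<subseteq># V + inv_seq V \<Longrightarrow> A = V \<or> A = inv_seq V \<or> size A = 2"
  shows "lengths G (V + inv_seq V) = {2, size V}"
proof
  show "lengths G (V + inv_seq V) \<subseteq> {2, size V}"
  proof
    fix k assume "k \<in> lengths G (V + inv_seq V)"
    then obtain F where F: "size F = k" "set_mset F \<subseteq> atoms G" "sum_mset F = V + inv_seq V"
      by (auto simp: lengths_def)
    consider "V \<in># F" | "inv_seq V \<in># F" | "V \<notin># F" "inv_seq V \<notin># F" by blast
    then show "k \<in> {2, size V}"
    proof cases
      case 1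
      then obtain F' where F': "F = add_mset V F'" by (metis multi_member_split)
      have "F' = {#inv_seq V#}"
        using F F' V by (intro atom_factorization) (auto simp: atom_inv_seq)
      with F F' show ?thesis by auto
    next
      case 2
      then obtain F' where F': "F = add_mset (inv_seq V) F'" by (metis multi_member_split)
      have "F' = {#V#}"
        using F F' V by (intro atom_factorization) (auto simp: atom_inv_seq)
      with F F' show ?thesis by auto
    next
      case 3
      have "size A = 2" if "A \<in># F" for A
      proof -
        have "A \<subseteq># sum_mset F" using that by (metis mset_subset_eq_add_left multi_member_split sum_mset.add_mset)
        with F 3 that atoms[of A] show ?thesis by auto
      qed
      then have "size (sum_mset F) = 2 * size F"
        by (induction F) auto
      with F show ?thesis by simp
    qed
  qed
  show "{2, size V} \<subseteq> lengths G (V + inv_seq V)" using V by (rule two_davenport_in_lengths)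
qed

lemma sum_pairs:
  assumes "\<And>A. A \<in># F \<Longrightarrow> A \<in> product_one_sequences G \<and> size A = 2"
  shows "\<exists>X. set_mset X \<subseteq> carrier G \<and> sum_mset F = X + inv_seq X"
  using assms
proof (induction F)
  case empty
  show ?case by (rule exI[of _ "{#}"]) simp
next
  case (add A F)
  then obtain X where X: "set_mset X \<subseteq> carrier G" "sum_mset F = X + inv_seq X" by auto
  obtain x where "x \<in> carrier G" "A = {#x, inv x#}"
    using add.prems[of A] product_one_size_2 by auto
  with X show ?case by (intro exI[of _ "add_mset x X"]) auto
qed

lemma two_davenport_factorization:
  assumes "finite (carrier G)" "{2, davenport G} \<subseteq> lengths G S" "davenport G \<ge> 3"
  obtains A B X where "A \<in> atoms G" "B \<in> atoms G" "S = A + B"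
    "size A = davenport G" "size B = davenport G" "\<one> \<notin># S"
    "set_mset X \<subseteq> carrier G" "S = X + inv_seq X"
proof -
  obtain A B where AB: "A \<in> atoms G" "B \<in> atoms G" "S = A + B"
    using assms(2) by (auto simp: two_in_lengths_iff)
  obtain F where F: "size F = davenport G" "set_mset F \<subseteq> atoms G" "sum_mset F = S"
    using assms(2) by (auto simp: lengths_def)
  have le: "size A \<le> davenport G" "size B \<le> davenport G"
    using AB size_atom_le_davenport[OF assms(1)] by auto
  \<comment> \<open>A term \<open>\<one>\<close> would force every length to be 2, but D(G) >= 3 is
    a length.\<close>
  have one: "\<one> \<notin># S"
    using lengths_with_two_and_one[of S "davenport G"] assms(2,3) by auto
  have sz: "size S = size A + size B" using AB by simp
  have *: "2 * davenport G \<le> size S" "size S = 2 * davenport G \<longrightarrow> (\<forall>A\<in>#F. size A = 2)"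
    using size_sum_atoms[OF F(2)] one F(1,3) by simp_all
  \<comment> \<open>The chain 2 D(G) <= |S| = |A| + |B| <= 2 D(G) is an equality throughout, which
    also makes every atom of \<open>F\<close> a pair.\<close>
  have "size A = davenport G" "size B = davenport G" using *(1) sz le by linarith+
  moreover from this have "\<forall>A\<in>#F. size A = 2" using *(2) sz by linarith
  moreover obtain X where "set_mset X \<subseteq> carrier G" "S = X + inv_seq X"
    using sum_pairs[of F] F calculation(3) atom_product_one by blast
  ultimately show thesis using that AB one by blast
qed

end

lemma davenport_le_of_system_eq:
  assumes "group G" "finite (carrier G)" "group H" "finite (carrier H)"
    and eq: "system_of_lengths G = system_of_lengths H" and "davenport G \<ge> 3"
  shows "davenport G \<le> davenport H"
proof -
  interpret G: group G by fact
  interpret H: group H by fact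
  obtain A where A: "A \<in> atoms G" "size A = davenport G"
    using G.exists_atom_size_davenport assms by blast
  have "A + G.inv_seq A \<in> product_one_sequences G"
    using A by (simp add: G.product_one_add G.product_one_inv_seq G.atom_product_one)
  then have "lengths G (A + G.inv_seq A) \<in> system_of_lengths H"
    unfolding eq[symmetric] by (auto simp: system_of_lengths_def)
  then obtain T where "lengths G (A + G.inv_seq A) = lengths H T"
    by (auto simp: system_of_lengths_def)
  then have "{2, davenport G} \<subseteq> lengths H T"
    using G.two_davenport_in_lengths[of A] A assms by auto
  then have "davenport G \<le> max 2 (davenport H)"
    using H.lengths_with_two_le[OF assms(4)] by blast
  with assms show ?thesis by simp
qed

text \<open>The first inequality passes the bound 3 on to \<open>H\<close>, which allows the roles
  to be exchanged.\<close>

lemma davenport_eq_of_system_eq: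
  assumes "group G" "finite (carrier G)" "group H" "finite (carrier H)"
    and "system_of_lengths G = system_of_lengths H" and "davenport G \<ge> 3"
  shows "davenport G = davenport H"
  using davenport_le_of_system_eq[of G H] davenport_le_of_system_eq[of H G] assms by force

section \<open>Minimal product-one sequences\<close>

context group
begin

text \<open>
  Being minimal is stronger than being an atom: for a non-abelian group the complement of a
  product-one subsequence of a product-one sequence need not be a product-one sequence.
\<close>

definition minimal_product_one :: "'a multiset \<Rightarrow> bool"
  where "minimal_product_one V \<longleftrightarrow> V \<in> product_one_sequences G \<and> V \<noteq> {#} \<and>
    (\<forall>W\<in>product_one_sequences G. W \<subseteq># V \<longrightarrow> W = {#} \<or> W = V)"

lemma minimal_product_oneD:
  "minimal_product_one V \<Longrightarrow> W \<in> product_one_sequences G \<Longrightarrow> W \<subseteq># V \<Longrightarrow> W \<noteq> {#} \<Longrightarrow> W = V"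
  unfolding minimal_product_one_def by blast

lemma minimal_if_half:
  assumes "finite (carrier G)" "lengths G (V + inv_seq V) = {2, davenport G}"
    and V: "size V = davenport G" "davenport G \<ge> 3" "set_mset V \<subseteq> carrier G" "\<one> \<notin># V"
    and no_pair: "\<And>x. x \<in> carrier G \<Longrightarrow> \<not> {#x, inv x#} \<subseteq># V"
  shows "minimal_product_one V"
proof -
  have atom: "W = V" if W: "W \<in> atoms G" "W \<subseteq># V" for W
  proof -
    obtain R where R: "V = W + R" using W(2) by (metis subset_mset.add_diff_inverse)
    have "1 + 1 + size R \<in> lengths G ((W + inv_seq W) + (R + inv_seq R))"
      using W V(3,4) R by (intro lengths_add lengths_atom atom_inv_seq pairs_in_lengths) auto
    moreover have "(W + inv_seq W) + (R + inv_seq R) = V + inv_seq V"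
      using R by simp
    ultimately have "2 + size R \<in> {2, davenport G}" using assms(2) by simp
    \<comment> \<open>The length \<open>2 + size R\<close> can be D(G) only if |W| = 2, which the
      absence of pairs excludes. So it is 2, and \<open>W\<close> exhausts \<open>V\<close>.\<close>
    moreover have "size W \<noteq> 2"
      using product_one_size_2[OF atom_product_one[OF W(1)]] W(2) no_pair by metis
    moreover have "size W + size R = davenport G" using V(1) R by simp
    ultimately have "size R = 0" by auto
    with R show ?thesis by simp
  qed
  \<comment> \<open>\<open>V\<close> is not yet known to be product-one. Its length guarantees some
    nonempty product-one subsequence, and every such subsequence turns out to be
    \<open>V\<close>.\<close>
  obtain W0 where W0: "W0 \<in> product_one_sequences G" "W0 \<subseteq># V" "W0 \<noteq> {#}"
    using product_one_free_size[OF assms(1) V(3)] V(1) by (metis less_irrefl)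
  have all: "W = V" if W: "W \<in> product_one_sequences G" "W \<subseteq># V" "W \<noteq> {#}" for W
  proof -
    obtain A where "A \<in> atoms G" "A \<subseteq># W" using W(1,3) by (rule exists_atom_subseteq)
    with W(2) atom[of A] show ?thesis by (metis subset_mset.order_trans subset_mset.antisym)
  qed
  from all[OF W0] W0 have "V \<in> product_one_sequences G" "V \<noteq> {#}" by auto
  with all show ?thesis unfolding minimal_product_one_def by blast
qed

text \<open>An injection into the naturals orients each pair of inverse elements. Since all copies
  of a pair are oriented alike, the chosen half never contains both an element and its
  inverse.\<close>

lemma exists_half:
  assumes "finite (carrier G)" "set_mset X \<subseteq> carrier G"
    and no_inv: "\<And>x. x \<in># X \<Longrightarrow> inv x \<noteq> x"
  obtains V where "set_mset V \<subseteq> carrier G" "X + inv_seq X = V + inv_seq V"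
    "\<And>x. x \<in> carrier G \<Longrightarrow> \<not> {#x, inv x#} \<subseteq># V"
proof -
  obtain f :: "'a \<Rightarrow> nat" where f: "inj_on f (carrier G)"
    using finite_imp_inj_to_nat_seg[OF assms(1)] by blast
  define P where "P x \<longleftrightarrow> f x < f (inv x)" for x
  have P: "P (inv x) \<longleftrightarrow> \<not> P x" if "x \<in> carrier G" "inv x \<noteq> x" for x
  proof -
    have "f x \<noteq> f (inv x)" using that inj_onD[OF f, of x "inv x"] by auto
    then show ?thesis using that(1) unfolding P_def by (simp add: not_less) linarith
  qed
  define S where "S = X + inv_seq X"
  have S: "set_mset S \<subseteq> carrier G" using assms(2) by (auto simp: S_def)
  have cS: "count S (inv x) = count S x" if "x \<in> carrier G" for x
    using that assms(2) by (simp add: S_def count_inv_seq)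
  have nS: "inv x \<noteq> x" if xS: "x \<in># S" for x
  proof -
    consider "x \<in># X" | y where "y \<in># X" "x = inv y" using xS by (auto simp: S_def)
    then show ?thesis
    proof cases
      case 1
      then show ?thesis by (rule no_inv)
    next
      case (2 y)
      then have "y \<in> carrier G" using assms(2) by auto
      with 2 no_inv[of y] show ?thesis by simp
    qed
  qed
  define V where "V = filter_mset P S"
  have V: "set_mset V \<subseteq> carrier G" using S by (auto simp: V_def)
  have "S = V + inv_seq V"
  proof (rule multiset_eqI)
    fix x
    show "count S x = count (V + inv_seq V) x"
    proof (cases "x \<in># S")
      case True
      with S have x: "x \<in> carrier G" by auto
      \<comment> \<open>Exactly one of \<open>x\<close> and \<open>inv x\<close> satisfies
        \<open>P\<close>, so exactly one of the two summands contains \<open>x\<close>, and it does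
        so as often as \<open>S\<close>, whose multiplicities are invariant under inversion.\<close>
      show ?thesis
        using P[OF x nS[OF True]] x V cS[OF x] by (auto simp: count_inv_seq) (auto simp: V_def)
    next
      case False
      have "x \<notin># inv_seq V"
      proof
        assume "x \<in># inv_seq V"
        then obtain y where y: "y \<in># S" "x = inv y" by (auto simp: V_def)
        with S have "y \<in> carrier G" by auto
        with y cS[of y] have "count S x = count S y" by simp
        with y False show False by (metis count_greater_zero_iff)
      qed
      then have "count (inv_seq V) x = 0" by (simp only: not_in_iff)
      moreover have "count V x = 0" using False by (simp add: not_in_iff V_def)
      ultimately show ?thesis using False by (simp add: not_in_iff)
    qed
  qed
  moreover have "\<not> {#x, inv x#} \<subseteq># V" if "x \<in> carrier G" for x
  proof
    assume sub: "{#x, inv x#} \<subseteq># V"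
    have "x \<in># V" "inv x \<in># V" using mset_subset_eqD[OF sub] by auto
    then have "P x" "P (inv x)" "inv x \<noteq> x" using nS by (auto simp: V_def)
    with P[OF that] show False by simp
  qed
  ultimately show thesis using that V unfolding S_def by blast
qed

text \<open>
  For an ordering of \<open>V\<close> with product \<open>y\<close>, adding \<open>inv y\<close> gives a product-one sequence longer than
  every atom; one of its two factors lies in \<open>V\<close>, so it is \<open>V\<close> and the other factor is \<open>\<one>\<close>.
\<close>

lemma minimal_all_orderings:
  assumes "finite (carrier G)" "minimal_product_one V" "size V = davenport G" "mset xs = V"
  shows "foldr (\<otimes>) xs \<one> = \<one>"
proof -
  have V: "V \<in> product_one_sequences G" using assms(2) by (simp add: minimal_product_one_def)
  have c: "set xs \<subseteq> carrier G" using product_one_carrier[OF V] assms(4) by auto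
  define z where "z = inv (foldr (\<otimes>) xs \<one>)"
  have z: "z \<in> carrier G" "z \<otimes> foldr (\<otimes>) xs \<one> = \<one>"
    using multlist_closed[OF c] by (simp_all add: z_def)
  have "mset (z # xs) \<in> product_one_sequences G"
    using z c by (intro product_one_sequencesI) auto
  then have "add_mset z V \<in> product_one_sequences G" using assms(4) by simp
  moreover have "add_mset z V \<notin> atoms G"
    using size_atom_le_davenport[OF assms(1), of "add_mset z V"] assms(3) by auto
  moreover have "add_mset z V \<noteq> {#}" by simp
  ultimately obtain S T where ST: "S \<in> product_one_sequences G" "T \<in> product_one_sequences G"
    "add_mset z V = S + T" "S \<noteq> {#}" "T \<noteq> {#}"
    unfolding atoms_iff by blast
  from add_mset_eq_union_subseteq[OF ST(3)] have "S = V \<or> T = V"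
    using minimal_product_oneD[OF assms(2)] ST by blast
  then have "{#z#} \<in> product_one_sequences G"
  proof
    assume "S = V"
    with ST(3) have "T = {#z#}" by (metis add_mset_add_single add_left_cancel)
    with ST(2) show ?thesis by simp
  next
    assume "T = V"
    with ST(3) have "S = {#z#}" by (metis add_mset_add_single add_right_cancel union_commute)
    with ST(1) show ?thesis by simp
  qed
  then have "z = \<one>" by (simp add: product_one_single)
  with z multlist_closed[OF c] show ?thesis by simp
qed

text \<open>Two orderings that differ only in the order of their first two terms both have product
  one; the common tail cancels.\<close>

lemma minimal_commute:
  assumes "finite (carrier G)" "minimal_product_one V" "size V = davenport G"
    and "x \<in># V" "y \<in># V"
  shows "x \<otimes> y = y \<otimes> x"
proof (cases "x = y")
  case False
  obtain V' where V': "V = add_mset x V'" using assms(4) by (metis multi_member_split)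
  with assms(5) False have "y \<in># V'" by simp
  then obtain V'' where "V' = add_mset y V''" by (metis multi_member_split)
  with V' have V'': "V = add_mset x (add_mset y V'')" by simp
  obtain zs where zs: "mset zs = V''" using ex_mset by blast
  have "set_mset V \<subseteq> carrier G"
    using assms(2) product_one_carrier by (auto simp: minimal_product_one_def)
  with V'' zs have c: "x \<in> carrier G" "y \<in> carrier G" "set zs \<subseteq> carrier G" by auto
  have "foldr (\<otimes>) (x # y # zs) \<one> = \<one>" "foldr (\<otimes>) (y # x # zs) \<one> = \<one>"
    by (rule minimal_all_orderings[OF assms(1-3)], simp add: V'' zs add_mset_commute)+
  then have "(x \<otimes> y) \<otimes> foldr (\<otimes>) zs \<one> = (y \<otimes> x) \<otimes> foldr (\<otimes>) zs \<one>"
    using c multlist_closed[OF c(3)] by (simp add: m_assoc)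
  then show ?thesis using c multlist_closed[OF c(3)] by simp
qed simp

lemma foldr_in_subgroup:
  assumes "subgroup K G" "set xs \<subseteq> K"
  shows "foldr (\<otimes>) xs \<one> \<in> K"
  using assms(2) by (induction xs) (auto simp: subgroup.one_closed[OF assms(1)] subgroup.m_closed[OF assms(1)])

text \<open>Exchange a term \<open>g\<close> of \<open>V\<close> for an arbitrary \<open>h\<close>.
  The new sequence still has length D(G), so it contains a nonempty product-one \<open>W\<close>. By
  minimality of \<open>V\<close>, \<open>W\<close> does not lie in the old terms \<open>T\<close>,
  so \<open>h\<close> occurs in it, and the equation for an ordering of \<open>W\<close> can be
  solved for \<open>h\<close> in terms of elements of \<open>K\<close>.\<close>

lemma minimal_generates:
  assumes "finite (carrier G)" "minimal_product_one V" "size V = davenport G"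
    and K: "subgroup K G" "set_mset V \<subseteq> K"
  shows "K = carrier G"
proof
  show "K \<subseteq> carrier G" using K(1) by (rule subgroup.subset)
  show "carrier G \<subseteq> K"
  proof
    fix h assume h: "h \<in> carrier G"
    have "V \<noteq> {#}" using assms(2) by (simp add: minimal_product_one_def)
    then obtain g T where gT: "V = add_mset g T" by (metis multiset_cases)
    have Vc: "set_mset V \<subseteq> carrier G"
      using assms(2) product_one_carrier by (auto simp: minimal_product_one_def)
    have "set_mset (add_mset h T) \<subseteq> carrier G" "\<not> size (add_mset h T) < davenport G"
      using h gT Vc assms(3) by auto
    with product_one_free_size[OF assms(1)]
    obtain W where W: "W \<in> product_one_sequences G" "W \<subseteq># add_mset h T" "W \<noteq> {#}" by blast
    have "h \<in># W"
    proof (rule ccontr)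
      assume "h \<notin># W"
      have WT: "W \<subseteq># T"
      proof (rule mset_subset_eqI)
        fix a
        show "count W a \<le> count T a"
          using mset_subset_eq_count[OF W(2), of a] \<open>h \<notin># W\<close> by (cases "a = h") (auto simp: not_in_iff)
      qed
      moreover have "T \<subseteq># V" using gT by simp
      ultimately have "W = V" using W(1,3) minimal_product_oneD[OF assms(2)]
        by (blast intro: subset_mset.order_trans)
      with WT gT size_mset_mono[of V T] show False by simp
    qed
    obtain ys where ys: "mset ys = W" "set ys \<subseteq> carrier G" "foldr (\<otimes>) ys \<one> = \<one>"
      using W(1) by (rule product_one_sequencesE)
    with \<open>h \<in># W\<close> obtain p q where pq: "ys = p @ h # q" by (metis set_mset_mset split_list)
    have "W = add_mset h (mset p + mset q)" using ys(1) pq by simp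
    then have "mset p + mset q \<subseteq># T" using W(2) by simp
    then have "set_mset (mset p + mset q) \<subseteq> set_mset T" by (rule set_mset_mono)
    then have sub: "set p \<subseteq> K" "set q \<subseteq> K" using gT K(2) by auto
    define P Q where "P = foldr (\<otimes>) p \<one>" and "Q = foldr (\<otimes>) q \<one>"
    have PQ: "P \<in> K" "Q \<in> K" unfolding P_def Q_def using foldr_in_subgroup[OF K(1)] sub by auto
    have PQc: "P \<in> carrier G" "Q \<in> carrier G" using PQ subgroup.subset[OF K(1)] by auto
    have "P \<otimes> (h \<otimes> Q) = \<one>"
      using ys(2,3) pq foldr_append_mult[of p "h # q"]
      by (simp add: P_def Q_def del: foldr_append)
    then have "inv (h \<otimes> Q) = P" using PQc h by (intro inv_equality) auto
    then have "inv P = h \<otimes> Q" using PQc h by (metis inv_inv m_closed)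
    then have "h = inv P \<otimes> inv Q" using PQc h by (simp add: m_assoc)
    then show "h \<in> K" using PQ K(1) by (simp add: subgroup.m_closed subgroup.m_inv_closed)
  qed
qed

lemma subgroup_centralizer:
  assumes "A \<subseteq> carrier G"
  shows "subgroup {z \<in> carrier G. \<forall>a\<in>A. a \<otimes> z = z \<otimes> a} G"
proof (rule subgroupI)
  fix z assume "z \<in> {z \<in> carrier G. \<forall>a\<in>A. a \<otimes> z = z \<otimes> a}"
  then have z: "z \<in> carrier G" "\<And>a. a \<in> A \<Longrightarrow> a \<otimes> z = z \<otimes> a" by auto
  have "a \<otimes> inv z = inv z \<otimes> a" if "a \<in> A" for a
  proof -
    have a: "a \<in> carrier G" using that assms by auto
    have "a \<otimes> inv z = inv z \<otimes> (z \<otimes> a) \<otimes> inv z"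
      using a z(1) by (simp flip: m_assoc)
    also have "\<dots> = inv z \<otimes> (a \<otimes> z) \<otimes> inv z" using z(2)[OF that] by simp
    also have "\<dots> = inv z \<otimes> a" using a z(1) by (simp add: m_assoc)
    finally show ?thesis .
  qed
  with z(1) show "inv z \<in> {z \<in> carrier G. \<forall>a\<in>A. a \<otimes> z = z \<otimes> a}" by simp
next
  fix z w
  assume "z \<in> {z \<in> carrier G. \<forall>a\<in>A. a \<otimes> z = z \<otimes> a}" "w \<in> {z \<in> carrier G. \<forall>a\<in>A. a \<otimes> z = z \<otimes> a}"
  then have zw: "z \<in> carrier G" "w \<in> carrier G"
    "\<And>a. a \<in> A \<Longrightarrow> a \<otimes> z = z \<otimes> a" "\<And>a. a \<in> A \<Longrightarrow> a \<otimes> w = w \<otimes> a" by auto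
  have "a \<otimes> (z \<otimes> w) = z \<otimes> w \<otimes> a" if "a \<in> A" for a
  proof -
    have a: "a \<in> carrier G" using that assms by auto
    have "a \<otimes> (z \<otimes> w) = z \<otimes> (a \<otimes> w)" using a zw(1,2) zw(3)[OF that] by (simp flip: m_assoc)
    also have "\<dots> = z \<otimes> w \<otimes> a" using a zw(1,2) zw(4)[OF that] by (simp add: m_assoc)
    finally show ?thesis .
  qed
  with zw(1,2) show "z \<otimes> w \<in> {z \<in> carrier G. \<forall>a\<in>A. a \<otimes> z = z \<otimes> a}" by simp
next
  show "{z \<in> carrier G. \<forall>a\<in>A. a \<otimes> z = z \<otimes> a} \<noteq> {}"
    using assms by (auto simp: subset_iff intro!: exI[of _ \<one>])
qed auto

text \<open>Generation is applied to centralizers twice. The centralizer of the terms of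
  \<open>V\<close> contains these terms, hence is all of \<open>G\<close>; so the terms are central,
  and the center is all of \<open>G\<close> as well.\<close>

lemma minimal_imp_comm_group:
  assumes "finite (carrier G)" "minimal_product_one V" "size V = davenport G"
  shows "comm_group G"
proof -
  have Vc: "set_mset V \<subseteq> carrier G"
    using assms(2) product_one_carrier by (auto simp: minimal_product_one_def)
  have first: "{z \<in> carrier G. \<forall>a\<in>set_mset V. a \<otimes> z = z \<otimes> a} = carrier G"
    using Vc minimal_commute[OF assms]
    by (intro minimal_generates[OF assms] subgroup_centralizer) auto
  have *: "z \<otimes> a = a \<otimes> z" if "a \<in># V" "z \<in> carrier G" for a z
  proof -
    have "z \<in> {z \<in> carrier G. \<forall>a\<in>set_mset V. a \<otimes> z = z \<otimes> a}" using that(2) first by simp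
    with that(1) show ?thesis by simp
  qed
  then have "{z \<in> carrier G. \<forall>a\<in>carrier G. a \<otimes> z = z \<otimes> a} = carrier G"
    using Vc * by (intro minimal_generates[OF assms] subgroup_centralizer) (auto simp: subset_iff)
  then show ?thesis by (intro group_comm_groupI) blast
qed

section \<open>Groups of odd order in which {2, D(G)} is a set of lengths\<close>

lemma odd_order_involution:
  assumes "finite (carrier G)" "odd (order G)" "x \<in> carrier G" "inv x = x"
  shows "x = \<one>"
proof -
  have "x \<otimes> x = \<one>" using assms(3,4) by (metis r_inv)
  then have "x [^] (2::nat) = \<one>" using assms(3) by (simp add: numeral_2_eq_2)
  then have "ord x dvd 2" using assms(3) by (simp add: pow_eq_id)
  then have "ord x \<noteq> 0" "ord x \<le> 2" by (auto dest: dvd_imp_le intro!: Nat.gr0I)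
  moreover have "ord x \<noteq> 2" using ord_dvd_group_order[OF assms(3)] assms(2) by auto
  ultimately have "ord x = 1" by linarith
  then show ?thesis using assms(3) ord_eq_1 by simp
qed

lemma odd_order_comm_group:
  assumes fin: "finite (carrier G)" and odd: "odd (order G)" and D: "davenport G \<ge> 3"
    and "{2, davenport G} \<in> system_of_lengths G"
  shows "comm_group G"
proof -
  obtain S where S: "lengths G S = {2, davenport G}"
    using assms(4) by (auto simp: system_of_lengths_def)
  obtain A B X where X: "S = A + B" "size A = davenport G" "size B = davenport G"
    "\<one> \<notin># S" "set_mset X \<subseteq> carrier G" "S = X + inv_seq X"
    using two_davenport_factorization[OF fin _ D, of S] S by (metis order_refl)
  \<comment> \<open>Oddness enters here: a self-inverse term would be \<open>\<one>\<close>, which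
    does not occur in \<open>S\<close>.\<close>
  have "inv x \<noteq> x" if "x \<in># X" for x
    using that X(4-6) odd_order_involution[OF fin odd, of x] by auto
  then obtain V where V: "set_mset V \<subseteq> carrier G" "X + inv_seq X = V + inv_seq V"
    "\<And>x. x \<in> carrier G \<Longrightarrow> \<not> {#x, inv x#} \<subseteq># V"
    using exists_half[OF fin X(5)] by metis
  have "size S = 2 * davenport G" using X(1-3) by simp
  then have szV: "size V = davenport G" using X(6) V(2) by simp
  have "\<one> \<notin># V" using X(4,6) V(2) by (metis union_iff)
  moreover have "lengths G (V + inv_seq V) = {2, davenport G}" using S X(6) V(2) by simp
  ultimately have "minimal_product_one V"
    using V szV D by (intro minimal_if_half[OF fin]) simp_all
  with szV show ?thesis using minimal_imp_comm_group[OF fin] by blast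
qed

end

section \<open>Abelian groups\<close>

lemma pair_subseteq_mset_iff:
  "{#x, y#} \<subseteq># A \<longleftrightarrow> (if x = y then 2 \<le> count A x else x \<in># A \<and> y \<in># A)"
proof -
  have "{#x, y#} \<subseteq># A \<longleftrightarrow> x \<in># A \<and> y \<in># A - {#x#}"
    by (simp add: insert_subset_eq_iff)
  also have "\<dots> \<longleftrightarrow> (if x = y then 2 \<le> count A x else x \<in># A \<and> y \<in># A)"
    by (auto simp: count_greater_zero_iff[symmetric] simp del: count_greater_zero_iff)
  finally show ?thesis .
qed

context group
begin

lemma funpow_mult_one: "g \<in> carrier G \<Longrightarrow> ((\<otimes>) g ^^ m) \<one> = g [^] m"
proof (induction m)
  case (Suc m)
  then show ?case using nat_pow_Suc2[of g m] by simp
qed simp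

lemma minimal_no_pair:
  assumes "minimal_product_one A" "size A \<ge> 3" "x \<in> carrier G"
  shows "\<not> {#x, inv x#} \<subseteq># A"
proof
  assume "{#x, inv x#} \<subseteq># A"
  then have "{#x, inv x#} = A"
    using minimal_product_oneD[OF assms(1) product_one_pair[OF assms(3)]] by simp
  then show False using assms(2) by auto
qed

text \<open>Minimality forces \<open>ord g\<close> to be D(G), since \<open>ord g\<close> copies of
  \<open>g\<close> already have product one; the single term \<open>g\<close> generates
  \<open>G\<close> by \<open>minimal_generates\<close>.\<close>

lemma minimal_replicate:
  assumes "finite (carrier G)" "g \<in> carrier G"
    and min: "minimal_product_one (replicate_mset (davenport G) g)"
  shows "cyclic_group G" "order G = davenport G"
proof -
  have D: "g [^] davenport G = \<one>"
    using minimal_all_orderings[OF assms(1) min, of "replicate (davenport G) g"] assms(2)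
    by (simp add: funpow_mult_one)
  then have "ord g dvd davenport G" using assms(2) by (simp add: pow_eq_id)
  moreover have "davenport G > 0" using min by (auto simp: minimal_product_one_def intro: Nat.gr0I)
  ultimately have ord: "ord g > 0" "ord g \<le> davenport G"
    by (auto dest: dvd_imp_le intro: Nat.gr0I)
  have "mset (replicate (ord g) g) \<in> product_one_sequences G"
    using assms(2) by (intro product_one_sequencesI) (auto simp: funpow_mult_one)
  then have "replicate_mset (ord g) g = replicate_mset (davenport G) g"
    using ord by (intro minimal_product_oneD[OF min])
      (auto simp: replicate_mset_msubseteq_iff)
  then have "ord g = davenport G" by (metis size_replicate_mset)
  moreover have *: "generate G {g} = carrier G"
    using assms(2) by (intro minimal_generates[OF assms(1) min] generate_is_subgroup)
      (auto intro: generate.incl)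
  ultimately show "order G = davenport G"
    using generate_pow_card[OF assms(2)] by (simp add: order_def)
  show "cyclic_group G"
  proof -
    have "carrier G = range (\<lambda>k::int. g [^] k)"
      unfolding *[symmetric] generate_pow[OF assms(2)] by auto
    with assms(2) show ?thesis unfolding cyclic_group by blast
  qed
qed

text \<open>Two equal prefix products cut out a block of consecutive terms with product one. As the
  indices start at 1, this block omits the first term, so it is a proper subsequence.\<close>

lemma minimal_prefix_products_inj:
  assumes "minimal_product_one (mset xs)"
  shows "inj_on (\<lambda>k. foldr (\<otimes>) (take k xs) \<one>) {1..length xs}"
proof -
  have c: "set xs \<subseteq> carrier G"
    using assms product_one_carrier[of "mset xs"] by (simp add: minimal_product_one_def)
  have "foldr (\<otimes>) (take i xs) \<one> \<noteq> foldr (\<otimes>) (take j xs) \<one>"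
    if ij: "1 \<le> i" "i < j" "j \<le> length xs" for i j
  proof
    assume eq: "foldr (\<otimes>) (take i xs) \<one> = foldr (\<otimes>) (take j xs) \<one>"
    define ys where "ys = drop i (take j xs)"
    have tj: "take j xs = take i xs @ ys"
      using ij by (metis ys_def append_take_drop_id min.absorb1 less_imp_le take_take)
    have xs: "xs = take i xs @ ys @ drop j xs"
      using append_take_drop_id[of j xs] tj by simp
    have ci: "set (take i xs) \<subseteq> carrier G" "set ys \<subseteq> carrier G"
      using c xs set_take_subset[of i xs] set_drop_subset[of i "take j xs"] set_take_subset[of j xs]
      by (auto simp: ys_def)
    have "foldr (\<otimes>) (take i xs) \<one> \<otimes> foldr (\<otimes>) ys \<one> = foldr (\<otimes>) (take i xs) \<one>"
      using foldr_append_mult[OF ci] tj eq by simp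
    then have "foldr (\<otimes>) ys \<one> = \<one>"
      using multlist_closed[OF ci(1)] multlist_closed[OF ci(2)] by simp
    then have "mset ys \<in> product_one_sequences G" using ci by (intro product_one_sequencesI)
    moreover have "mset xs = mset (take i xs) + mset ys + mset (drop j xs)"
      using arg_cong[OF xs, of mset] by simp
    then have "mset ys \<subseteq># mset xs" by (metis mset_subset_eq_add_left mset_subset_eq_add_right subset_mset.order_trans)
    moreover have "length ys = j - i" using ij by (simp add: ys_def)
    then have "mset ys \<noteq> {#}" using ij by auto
    ultimately have "mset ys = mset xs" using minimal_product_oneD[OF assms] by blast
    then have "length ys = length xs" by (metis size_mset)
    with \<open>length ys = j - i\<close> ij show False by simp
  qed
  then show ?thesis by (auto simp: inj_on_def) (metis linorder_neqE_nat Suc_le_eq)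
qed

text \<open>
  The prefix products of an ordering exhaust the group. Exchanging the first two terms changes only
  the first of these products, which therefore cannot change at all.
\<close>

lemma minimal_size_order:
  assumes "finite (carrier G)" "comm_group G"
    and min: "minimal_product_one U" "size U = order G"
    and "x \<in># U" "y \<in># U"
  shows "x = y"
proof (rule ccontr)
  assume "x \<noteq> y"
  interpret comm_group G by fact
  obtain U' where U': "U = add_mset x U'" using assms(5) by (metis multi_member_split)
  with assms(6) \<open>x \<noteq> y\<close> have "y \<in># U'" by simp
  then obtain U'' where "U' = add_mset y U''" by (metis multi_member_split)
  with U' have U'': "U = add_mset x (add_mset y U'')" by simp
  obtain zs where zs: "mset zs = U''" using ex_mset by blast
  have "set_mset U \<subseteq> carrier G"
    using min(1) product_one_carrier by (auto simp: minimal_product_one_def)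
  with U'' zs have c: "x \<in> carrier G" "y \<in> carrier G" "set zs \<subseteq> carrier G" by auto
  define n where "n = length zs + 2"
  have n: "n = order G" using min(2) U'' zs by (auto simp: n_def)
  define p where "p us k = foldr (\<otimes>) (take k us) \<one>" for us and k :: nat
  have sp: "{1..n} = insert 1 {2..n}" by (auto simp: n_def)
  have *: "p us ` {2..n} = carrier G - {a}"
    if us: "us = a # b # zs" "mset us = U" for us a b
  proof -
    have inj: "inj_on (p us) {1..n}"
      using minimal_prefix_products_inj[of us] us min(1) unfolding p_def n_def by simp
    have "p us ` {1..n} \<subseteq> carrier G"
    proof safe
      fix k
      have "set (take k us) \<subseteq> carrier G"
        using set_take_subset[of k us] us(2) \<open>set_mset U \<subseteq> carrier G\<close> by (metis subset_trans set_mset_mset)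
      then show "p us k \<in> carrier G" unfolding p_def by (rule multlist_closed)
    qed
    moreover have "card (p us ` {1..n}) = card (carrier G)"
      using card_image[OF inj] n by (simp add: order_def)
    ultimately have im: "p us ` {1..n} = carrier G"
      using assms(1) by (metis card_subset_eq)
    have "a \<in> carrier G" using us \<open>set_mset U \<subseteq> carrier G\<close> by auto
    then have "p us 1 = a" using us by (simp add: p_def)
    moreover have "p us 1 \<notin> p us ` {2..n}"
      using inj unfolding sp by (auto simp: inj_on_def)
    ultimately show ?thesis
      using im unfolding sp image_insert by (metis Diff_insert_absorb)
  qed
  have "p (x # y # zs) k = p (y # x # zs) k" if "k \<in> {2..n}" for k
  proof -
    define l where "l = k - 2"
    have k: "k = Suc (Suc l)" using that unfolding l_def atLeastAtMost_iff by arith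
    have "set (take l zs) \<subseteq> carrier G" using c(3) set_take_subset[of l zs] by blast
    then show ?thesis using c multlist_closed[of "take l zs"] by (simp add: p_def k m_lcomm)
  qed
  then have "p (x # y # zs) ` {2..n} = p (y # x # zs) ` {2..n}" by (intro image_cong) auto
  moreover have "mset (x # y # zs) = U" "mset (y # x # zs) = U"
    using U'' zs by (simp_all add: add_mset_commute)
  ultimately have "carrier G - {x} = carrier G - {y}" using * by metis
  with c \<open>x \<noteq> y\<close> show False by blast
qed

end

context comm_group
begin

lemma mset_product_one_iff:
  assumes "set xs \<subseteq> carrier G"
  shows "mset xs \<in> product_one_sequences G \<longleftrightarrow> foldr (\<otimes>) xs \<one> = \<one>"
proof
  assume "mset xs \<in> product_one_sequences G"
  then obtain ys where "mset ys = mset xs" "set ys \<subseteq> carrier G" "foldr (\<otimes>) ys \<one> = \<one>"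
    by (rule product_one_sequencesE)
  with multlist_perm_cong[of ys xs] show "foldr (\<otimes>) xs \<one> = \<one>" by simp
qed (use assms product_one_sequencesI in blast)

lemma replicate_product_one_iff:
  assumes "g \<in> carrier G" "set qs \<subseteq> carrier G"
  shows "replicate_mset i g + mset qs \<in> product_one_sequences G
    \<longleftrightarrow> g [^] i \<otimes> foldr (\<otimes>) qs \<one> = \<one>"
proof -
  have c: "set (replicate i g) \<subseteq> carrier G" using assms by auto
  have "replicate_mset i g + mset qs = mset (replicate i g @ qs)" by simp
  moreover have "set (replicate i g @ qs) \<subseteq> carrier G" using assms by auto
  ultimately show ?thesis
    using foldr_append_mult[OF c assms(2)] assms(1)
    by (simp add: mset_product_one_iff funpow_mult_one del: foldr_append mset_append)
qed

text \<open>In an abelian group the product does not depend on the ordering, so the complement of a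
  product-one subsequence is product-one and irreducibility applies to it.\<close>

lemma atom_minimal:
  assumes "A \<in> atoms G"
  shows "minimal_product_one A"
proof -
  have "W = {#} \<or> W = A" if W: "W \<in> product_one_sequences G" "W \<subseteq># A" for W
  proof -
    obtain R where R: "A = W + R" using W(2) by (metis subset_mset.add_diff_inverse)
    obtain ws where ws: "mset ws = W" "set ws \<subseteq> carrier G" "foldr (\<otimes>) ws \<one> = \<one>"
      using W(1) by (rule product_one_sequencesE)
    obtain rs where rs: "mset rs = R" using ex_mset by blast
    have A: "A \<in> product_one_sequences G" using assms by (rule atom_product_one)
    have c: "set rs \<subseteq> carrier G" using product_one_carrier[OF A] R rs by auto
    have "mset (ws @ rs) \<in> product_one_sequences G" using A R rs ws(1) by simp
    then have "foldr (\<otimes>) rs \<one> = \<one>"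
      using mset_product_one_iff[of "ws @ rs"] foldr_append_mult[OF ws(2) c] ws c
        multlist_closed[OF c] by (simp del: foldr_append mset_append)
    then have "R \<in> product_one_sequences G" using c rs product_one_sequencesI by blast
    with assms W(1) R have "W = {#} \<or> R = {#}" unfolding atoms_iff by blast
    with R show ?thesis by auto
  qed
  with assms show ?thesis unfolding minimal_product_one_def atoms_iff by blast
qed

section \<open>Abelian groups and sets of lengths containing 2 and D(G)\<close>

lemma two_davenport_decomposition:
  assumes "finite (carrier G)" "{2, davenport G} \<subseteq> lengths G S" "davenport G \<ge> 3"
  obtains A where "A \<in> atoms G" "size A = davenport G" "S = A + inv_seq A" "\<one> \<notin># S"
proof -
  obtain A B X where X: "A \<in> atoms G" "B \<in> atoms G" "S = A + B"
    "size A = davenport G" "size B = davenport G" "\<one> \<notin># S"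
    "set_mset X \<subseteq> carrier G" "S = X + inv_seq X"
    using two_davenport_factorization[OF assms] by metis
  have cA: "set_mset A \<subseteq> carrier G" and cB: "set_mset B \<subseteq> carrier G"
    using X(1,2) product_one_carrier[OF atom_product_one] by auto
  have "B = inv_seq A"
  proof (rule multiset_eqI)
    fix x
    show "count B x = count (inv_seq A) x"
    proof (cases "x \<in> carrier G")
      case False
      have "x \<notin># B" "x \<notin># inv_seq A" using False cA cB by auto
      then have "count B x = 0" "count (inv_seq A) x = 0" by (simp_all only: not_in_iff)
      then show ?thesis by simp
    next
      case True
      have noA: "\<not> {#x, inv x#} \<subseteq># A" and noB: "\<not> {#x, inv x#} \<subseteq># B"
        using minimal_no_pair[OF atom_minimal[OF X(1)] _ True]
          minimal_no_pair[OF atom_minimal[OF X(2)] _ True] X(4,5) assms(3) by simp_all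
      have cS: "count A x + count B x = count X x + count X (inv x)"
        "count A (inv x) + count B (inv x) = count X (inv x) + count X x"
        using arg_cong[OF X(8), of "\<lambda>M. count M x"] arg_cong[OF X(8), of "\<lambda>M. count M (inv x)"]
          X(3,7) True by (simp_all add: count_inv_seq)
      have "count B x = count A (inv x)"
      \<comment> \<open>For an involution both multiplicities are at most 1 and their sum is even.
        Otherwise each of \<open>A\<close> and \<open>B\<close> misses \<open>x\<close> or
        \<open>inv x\<close>, and \<open>S\<close> contains both equally often.\<close>
      proof (cases "inv x = x")
        case True
        with noA noB have "count A x \<le> 1" "count B x \<le> 1" by (simp_all add: pair_subseteq_mset_iff)
        moreover have "even (count A x + count B x)" using cS(1) True by simp
        ultimately have "count A x = count B x" by presburger
        with True show ?thesis by simp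
      next
        case False
        with noA noB have "count A x = 0 \<or> count A (inv x) = 0" "count B x = 0 \<or> count B (inv x) = 0"
          by (auto simp: pair_subseteq_mset_iff not_in_iff)
        with cS show ?thesis by auto
      qed
      with True cA show ?thesis by (simp add: count_inv_seq)
    qed
  qed
  with X that show thesis by blast
qed

text \<open>
  Replacing all copies of \<open>g\<close> in \<open>A\<close> by \<open>inv g\<close> gives another half of the pairs of \<open>A + inv A\<close>,
  hence another minimal sequence; comparing the two products yields \<open>g [^] (2 * m) = \<one>\<close>. If \<open>A\<close> had
  a term \<open>x \<noteq> g\<close>, then \<open>2 * m - 1\<close> copies of \<open>g\<close> together with the other terms, without \<open>x\<close>, would
  be long enough to contain a product-one subsequence, which lies in one of the two halves.
\<close>

lemma minimal_half_replicate:
  assumes fin: "finite (carrier G)" and D: "davenport G \<ge> 3"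
    and A: "A \<in> atoms G" "size A = davenport G" "\<one> \<notin># A + inv_seq A"
    and L: "lengths G (A + inv_seq A) = {2, davenport G}"
    and g: "g \<in># A" "inv g \<noteq> g"
  shows "A = replicate_mset (davenport G) g"
proof (rule ccontr)
  assume neq: "A \<noteq> replicate_mset (davenport G) g"
  have minA: "minimal_product_one A" using A(1) by (rule atom_minimal)
  have cA: "set_mset A \<subseteq> carrier G" using A(1) by (intro product_one_carrier atom_product_one)
  with g have gc: "g \<in> carrier G" by auto
  have no_pair: "\<not> {#x, inv x#} \<subseteq># A" if "x \<in> carrier G" for x
    using minimal_no_pair[OF minA _ that] A(2) D by simp
  have ig: "inv g \<notin># A" using no_pair[OF gc] g by (simp add: pair_subseteq_mset_iff)
  define m where "m = count A g"
  define R where "R = filter_mset (\<lambda>y. y \<noteq> g) A"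
  have AR: "A = replicate_mset m g + R"
    using multiset_partition[of A "\<lambda>y. y = g"] by (simp add: m_def R_def filter_eq_replicate_mset)
  have mpos: "m > 0" using g(1) by (simp add: m_def)
  have gR: "g \<notin># R" by (simp add: R_def)
  have igR: "inv g \<notin># R" using ig AR by auto
  have cR: "set_mset R \<subseteq> carrier G" using cA AR by auto
  have szA: "m + size R = davenport G" using A(2) AR by (metis size_replicate_mset size_union)
  have "R \<noteq> {#}" using neq AR szA by auto
  then obtain x R' where R': "R = add_mset x R'" by (metis multiset_cases)
  have xg: "x \<noteq> g" "x \<noteq> inv g" using R' gR igR by auto
  define V where "V = replicate_mset m (inv g) + R"
  have eqV: "V + inv_seq V = A + inv_seq A" using gc AR by (simp add: V_def)
  have minV: "minimal_product_one V"
  proof (rule minimal_if_half[OF fin])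
    show "lengths G (V + inv_seq V) = {2, davenport G}" using L eqV by simp
    show "size V = davenport G" using szA by (simp add: V_def)
    show "davenport G \<ge> 3" by fact
    show "set_mset V \<subseteq> carrier G" using cR gc by (auto simp: V_def)
    show "\<one> \<notin># V" using A(3) eqV by (metis union_iff)
    fix y assume y: "y \<in> carrier G"
    show "\<not> {#y, inv y#} \<subseteq># V"
    proof
      assume sub: "{#y, inv y#} \<subseteq># V"
      \<comment> \<open>\<open>V\<close> contains no \<open>g\<close>, so a pair in \<open>V\<close>
        avoids \<open>g\<close> and \<open>inv g\<close> altogether. It lies in the unchanged part
        \<open>R\<close> and hence already in \<open>A\<close>.\<close>
      have "y \<in># V" "inv y \<in># V" using mset_subset_eqD[OF sub] by auto
      moreover have "g \<notin># V" using gR g(2) by (auto simp: V_def)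
      ultimately have ne: "y \<noteq> g" "inv y \<noteq> g" by auto
      then have ne': "y \<noteq> inv g" "inv y \<noteq> inv g" using y gc by auto
      have "{#y, inv y#} \<subseteq># A"
      proof (rule mset_subset_eqI)
        fix a
        show "count {#y, inv y#} a \<le> count A a"
          using mset_subset_eq_count[OF sub, of a] ne ne' by (auto simp: V_def AR split: if_splits)
      qed
      with no_pair[OF y] show False by simp
    qed
  qed
  obtain rs where rs: "mset rs = R" using ex_mset by blast
  then have crs: "set rs \<subseteq> carrier G" using cR by auto
  have "g [^] m \<otimes> foldr (\<otimes>) rs \<one> = \<one>"
    using replicate_product_one_iff[OF gc crs, of m] rs AR atom_product_one[OF A(1)] by simp
  moreover have "inv g [^] m \<otimes> foldr (\<otimes>) rs \<one> = \<one>"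
    using replicate_product_one_iff[OF inv_closed[OF gc] crs, of m] rs minV
    by (simp add: V_def minimal_product_one_def)
  ultimately have "g [^] m = inv g [^] m"
    using gc multlist_closed[OF crs] by (metis inv_closed nat_pow_closed r_cancel)
  then have "g [^] m \<otimes> g [^] m = \<one>" using gc by (metis nat_pow_closed nat_pow_inv r_inv)
  then have g2m: "g [^] (m + m) = \<one>" using gc by (simp add: nat_pow_mult)
  have "m \<noteq> 1"
  proof
    assume "m = 1"
    then have "g \<otimes> g = \<one>" using g2m gc by (simp add: numeral_2_eq_2)
    then have "inv g = g" using gc inv_equality by blast
    with g(2) show False by simp
  qed
  with mpos have m2: "m \<ge> 2" by simp
  \<comment> \<open>\<open>U\<close> has length D(G) + m - 2, which is why \<open>m \<ge> 2\<close>
    was needed. Taking 2m - 1 copies of \<open>g\<close> keeps the count below the relation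
    \<open>g [^] (m + m) = \<one>\<close>.\<close>
  define U where "U = replicate_mset (m + m - 1) g + R'"
  have cU: "set_mset U \<subseteq> carrier G" using gc cR R' by (auto simp: U_def)
  have "size U \<ge> davenport G" using szA R' m2 by (simp add: U_def)
  then obtain W where W: "W \<in> product_one_sequences G" "W \<subseteq># U" "W \<noteq> {#}"
    using product_one_free_size[OF fin cU] by (metis not_less)
  define i where "i = count W g"
  define Q where "Q = filter_mset (\<lambda>y. y \<noteq> g) W"
  have WQ: "W = replicate_mset i g + Q"
    using multiset_partition[of W "\<lambda>y. y = g"] by (simp add: i_def Q_def filter_eq_replicate_mset)
  have "count R' g = 0" using gR R' by (simp add: not_in_iff)
  then have i: "i \<le> m + m - 1"
    using mset_subset_eq_count[OF W(2), of g] by (simp add: i_def U_def)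
  have QR: "Q \<subseteq># R'"
  proof (rule mset_subset_eqI)
    fix a
    show "count Q a \<le> count R' a"
      using mset_subset_eq_count[OF W(2), of a] by (auto simp: Q_def U_def)
  qed
  have xQ: "count Q x < count R x" using mset_subset_eq_count[OF QR, of x] R' by simp
  have "R' \<subseteq># R" using R' by simp
  with QR have QR': "Q \<subseteq># R" by (rule subset_mset.order_trans)
  show False
  proof (cases "i \<le> m")
    case True
    have "W \<subseteq># A" unfolding WQ AR
      using True QR' by (intro subset_mset.add_mono) (auto simp: replicate_mset_msubseteq_iff)
    then have "W = A" using minimal_product_oneD[OF minA W(1) _ W(3)] by simp
    then have eq: "replicate_mset i g + Q = replicate_mset m g + R" unfolding WQ AR .
    have "count (replicate_mset i g + Q) x = count (replicate_mset m g + R) x" by (simp only: eq)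
    then have "count Q x = count R x" using xg(1) by simp
    with xQ show False by simp
  next
    case False
    \<comment> \<open>By that relation, \<open>i\<close> copies of \<open>g\<close> have the same
      product as \<open>2 * m - i\<close> copies of \<open>inv g\<close>. After this exchange
      \<open>W\<close> becomes a product-one subsequence of \<open>V\<close>, which still misses a
      copy of \<open>x\<close>.\<close>
    define j where "j = m + m - i"
    have j: "j > 0" "j \<le> m" "m + m = j + i" using False i m2 by (auto simp: j_def)
    have "g [^] j \<otimes> g [^] i = \<one>" using g2m gc j(3) by (simp add: nat_pow_mult)
    then have "inv (g [^] i) = g [^] j" using gc by (intro inv_equality) auto
    then have ij: "inv g [^] j = g [^] i" using gc by (metis inv_inv nat_pow_closed nat_pow_inv)
    obtain qs where qs: "mset qs = Q" using ex_mset by blast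
    have "set_mset Q \<subseteq> carrier G" using set_mset_mono[OF QR'] cR by auto
    then have cqs: "set qs \<subseteq> carrier G" using qs by auto
    have "g [^] i \<otimes> foldr (\<otimes>) qs \<one> = \<one>"
      using replicate_product_one_iff[OF gc cqs, of i] qs W(1) WQ by simp
    then have W': "replicate_mset j (inv g) + Q \<in> product_one_sequences G"
      using replicate_product_one_iff[OF inv_closed[OF gc] cqs, of j] qs ij by simp
    moreover have "replicate_mset j (inv g) + Q \<subseteq># V" unfolding V_def
      using j QR' by (intro subset_mset.add_mono) (auto simp: replicate_mset_msubseteq_iff)
    moreover have "replicate_mset j (inv g) + Q \<noteq> {#}" using j(1) by simp
    ultimately have eq: "replicate_mset j (inv g) + Q = V"
      using minimal_product_oneD[OF minV] by blast
    have "count Q x = count R x"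
      using arg_cong[OF eq, of "\<lambda>M. count M x"] xg unfolding V_def by simp
    with xQ show False by simp
  qed
qed

lemma two_davenport_dichotomy:
  assumes fin: "finite (carrier G)" and D: "davenport G \<ge> 3"
    and "{2, davenport G} \<in> system_of_lengths G"
  shows "(cyclic_group G \<and> order G = davenport G) \<or> (\<forall>x\<in>carrier G. inv x = x)"
proof -
  obtain S where S: "lengths G S = {2, davenport G}"
    using assms(3) by (auto simp: system_of_lengths_def)
  obtain A where A: "A \<in> atoms G" "size A = davenport G" "S = A + inv_seq A" "\<one> \<notin># S"
    using two_davenport_decomposition[OF fin _ D, of S] S by (metis order_refl)
  have minA: "minimal_product_one A" using A(1) by (rule atom_minimal)
  have cA: "set_mset A \<subseteq> carrier G" using A(1) by (intro product_one_carrier atom_product_one)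
  show ?thesis
  proof (cases "\<forall>x\<in>#A. inv x = x")
    case False
    then obtain g where g: "g \<in># A" "inv g \<noteq> g" by blast
    have "A = replicate_mset (davenport G) g"
      using A S g by (intro minimal_half_replicate[OF fin D]) auto
    moreover have "g \<in> carrier G" using g cA by auto
    ultimately show ?thesis using minimal_replicate[OF fin, of g] minA by simp
  next
    case True
    \<comment> \<open>In an abelian group the self-inverse elements form a subgroup. It contains all
      terms of \<open>A\<close>, and these generate \<open>G\<close>.\<close>
    have "subgroup {x \<in> carrier G. inv x = x} G"
    proof (rule subgroupI)
      show "{x \<in> carrier G. inv x = x} \<noteq> {}" using one_closed inv_one by blast
    qed (auto simp: inv_mult)
    from minimal_generates[OF fin minA A(2) this] True cA
    have "{x \<in> carrier G. inv x = x} = carrier G" by auto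
    then show ?thesis by auto
  qed
qed

text \<open>An atom containing both \<open>h\<close> and \<open>inv h\<close> is that pair; any
  other atom inside lies in one of the two minimal blocks and equals it. \<open>d \<ge> 3\<close>
  keeps \<open>h\<close> from being an involution.\<close>

lemma replicate_lengths:
  assumes "h \<in> carrier G" "replicate_mset d h \<in> atoms G" "d \<ge> 3"
  shows "lengths G (replicate_mset d h + inv_seq (replicate_mset d h)) = {2, d}"
proof -
  have "lengths G (replicate_mset d h + inv_seq (replicate_mset d h)) = {2, size (replicate_mset d h)}"
  proof (rule lengths_atom_inverse)
    fix W
    assume W: "W \<in> atoms G" "W \<subseteq># replicate_mset d h + inv_seq (replicate_mset d h)"
    have minW: "minimal_product_one W" using W(1) by (rule atom_minimal)
    have "W \<noteq> {#}" using W(1) empty_notin_atoms by metis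
    have hh: "inv h \<noteq> h"
    proof
      assume "inv h = h"
      then have "{#h, inv h#} \<subseteq># replicate_mset d h" using assms(3) by (simp add: pair_subseteq_mset_iff)
      with minimal_no_pair[OF atom_minimal[OF assms(2)] _ assms(1)] assms(3) show False by simp
    qed
    show "W = replicate_mset d h \<or> W = inv_seq (replicate_mset d h) \<or> size W = 2"
    proof (cases "h \<in># W \<and> inv h \<in># W")
      case True
      then have "{#h, inv h#} \<subseteq># W" using hh by (simp add: pair_subseteq_mset_iff)
      then have "{#h, inv h#} = W"
        using minimal_product_oneD[OF minW product_one_pair[OF assms(1)]] by simp
      then show ?thesis by auto
    next
      case False
      have "W \<subseteq># replicate_mset d h \<or> W \<subseteq># replicate_mset d (inv h)"
      proof (cases "h \<in># W")
        case True
        with False have "count W (inv h) = 0" by (simp add: not_in_iff)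
        have "count W a \<le> count (replicate_mset d h) a" for a
          using mset_subset_eq_count[OF W(2), of a] \<open>count W (inv h) = 0\<close> hh
          by (cases "a = inv h") (auto split: if_splits)
        then show ?thesis by (auto intro: mset_subset_eqI)
      next
        case False
        then have "count W h = 0" by (simp add: not_in_iff)
        have "count W a \<le> count (replicate_mset d (inv h)) a" for a
          using mset_subset_eq_count[OF W(2), of a] \<open>count W h = 0\<close> hh
          by (cases "a = h") (auto split: if_splits)
        then show ?thesis by (auto intro: mset_subset_eqI)
      qed
      then show ?thesis
      proof
        assume "W \<subseteq># replicate_mset d h"
        then show ?thesis
          using minimal_product_oneD[OF atom_minimal[OF assms(2)] atom_product_one[OF W(1)]] \<open>W \<noteq> {#}\<close>
          by blast
      next
        assume "W \<subseteq># replicate_mset d (inv h)"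
        then show ?thesis
          using minimal_product_oneD[OF atom_minimal[OF atom_inv_seq[OF assms(2)]] atom_product_one[OF W(1)]]
            \<open>W \<noteq> {#}\<close> by simp
      qed
    qed
  qed (use assms in auto)
  then show ?thesis by simp
qed

text \<open>\<open>sys\<close> fixes the structure of \<open>G\<close>, while the atom
  \<open>A\<close> behind \<open>L\<close> is arbitrary. If |G| = D(G), then
  \<open>minimal_size_order\<close> makes all terms of \<open>A\<close> equal; in an elementary
  2-group \<open>A\<close> is its own inverse.\<close>

lemma two_davenport_lengths_unique:
  assumes fin: "finite (carrier G)" and D: "davenport G \<ge> 3"
    and sys: "{2, davenport G} \<in> system_of_lengths G"
    and L: "L \<in> system_of_lengths G" "{2, davenport G} \<subseteq> L"
  shows "L = {2, davenport G}"
proof -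
  obtain S where S: "L = lengths G S" using L(1) by (auto simp: system_of_lengths_def)
  obtain A where A: "A \<in> atoms G" "size A = davenport G" "S = A + inv_seq A"
    using two_davenport_decomposition[OF fin _ D, of S] S L(2) by metis
  have minA: "minimal_product_one A" using A(1) by (rule atom_minimal)
  have cA: "set_mset A \<subseteq> carrier G" using A(1) by (intro product_one_carrier atom_product_one)
  from two_davenport_dichotomy[OF fin D sys] show ?thesis
  proof
    assume "cyclic_group G \<and> order G = davenport G"
    then have eq: "x = y" if "x \<in># A" "y \<in># A" for x y
      using minimal_size_order[OF fin comm_group_axioms minA] A(2) that by auto
    have "A \<noteq> {#}" using A(2) D by auto
    then obtain h where h: "h \<in># A" by (metis multiset_nonemptyE)
    have "set_mset A = {h}" using h eq by auto
    then have "A = replicate_mset (davenport G) h"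
      using A(2) by (metis set_mset_subset_singletonD order_refl)
    with A h cA D S show ?thesis using replicate_lengths[of h "davenport G"] by auto
  next
    assume inv: "\<forall>x\<in>carrier G. inv x = x"
    have "inv_seq A = image_mset id A" using inv cA by (intro image_mset_cong) auto
    then have iA: "inv_seq A = A" by simp
    have "lengths G (A + inv_seq A) = {2, size A}"
    proof (rule lengths_atom_inverse)
      fix W assume W: "W \<in> atoms G" "W \<subseteq># A + inv_seq A"
      have minW: "minimal_product_one W" using W(1) by (rule atom_minimal)
      have "W \<noteq> {#}" using W(1) empty_notin_atoms by metis
      show "W = A \<or> W = inv_seq A \<or> size W = 2"
      proof (cases "\<exists>x\<in>carrier G. {#x, inv x#} \<subseteq># W")
        case True
        then obtain x where "x \<in> carrier G" "{#x, inv x#} \<subseteq># W" by blast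
        then have "{#x, inv x#} = W"
          using minimal_product_oneD[OF minW product_one_pair] by simp
        then show ?thesis by auto
      next
        case False
        \<comment> \<open>Without a pair, \<open>W\<close> has multiplicities at most 1, and each of
          its terms occurs in \<open>A + A\<close>, hence in \<open>A\<close>.\<close>
        have "W \<subseteq># A"
        proof (rule mset_subset_eqI)
          fix x
          show "count W x \<le> count A x"
          proof (cases "x \<in># W")
            case True
            then have x: "x \<in> carrier G" using product_one_carrier[OF atom_product_one[OF W(1)]] by auto
            with False inv have "count W x \<le> 1" by (auto simp: pair_subseteq_mset_iff not_le)
            moreover have "count W x \<le> count A x + count A x"
              using mset_subset_eq_count[OF W(2), of x] iA by simp
            ultimately show ?thesis by linarith
          qed (simp add: not_in_iff)
        qed
        then show ?thesis
          using minimal_product_oneD[OF minA atom_product_one[OF W(1)]] \<open>W \<noteq> {#}\<close> by blast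
      qed
    qed (use A D in auto)
    with A S show ?thesis by simp
  qed
qed

end

text \<open>A generator repeated |G| times is an atom, since its powers are \<open>\<one>\<close>
  only at multiples of |G|. This meets the general bound of |G| on the length of atoms.\<close>

lemma (in group) cyclic_two_davenport:
  assumes fin: "finite (carrier G)" and cyc: "cyclic_group G" and ge: "order G \<ge> 3"
  shows "davenport G = order G" "{2, davenport G} \<in> system_of_lengths G"
proof -
  interpret comm_group G using cyc by (rule cyclic_imp_abelian_group)
  obtain g where g: "g \<in> carrier G" "carrier G = range (\<lambda>n::int. g [^] n)"
    using cyc by (auto simp: cyclic_group)
  have "generate G {g} = carrier G" using g generate_pow[OF g(1)] by auto
  then have ord: "ord g = order G" using generate_pow_card[OF g(1)] by (simp add: order_def)
  have po: "replicate_mset i g \<in> product_one_sequences G \<longleftrightarrow> order G dvd i" for i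
    using replicate_product_one_iff[OF g(1), of "[]" i] g(1) ord by (simp add: pow_eq_id)
  have "S = {#} \<or> T = {#}" if ST: "S \<in> product_one_sequences G" "T \<in> product_one_sequences G"
    "replicate_mset (order G) g = S + T" for S T
  proof -
    have "S \<subseteq># replicate_mset (order G) g" using ST(3) by simp
    then obtain i where "S = replicate_mset i g" "i \<le> order G"
      by (metis msubseteq_replicate_msetE)
    with po ST show ?thesis using ge by (auto dest!: dvd_imp_le)
  qed
  then have atom: "replicate_mset (order G) g \<in> atoms G"
    using po[of "order G"] ge by (auto simp: atoms_iff)
  from size_atom_le_davenport[OF fin this] davenport_le_order[OF fin]
  show *: "davenport G = order G" by simp
  have "replicate_mset (order G) g + inv_seq (replicate_mset (order G) g) \<in> product_one_sequences G"
    using atom by (intro product_one_add product_one_inv_seq atom_product_one)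
  then show "{2, davenport G} \<in> system_of_lengths G"
    using replicate_lengths[OF g(1) atom ge] * unfolding system_of_lengths_def by (metis image_eqI)
qed

lemma (in group) odd_two_davenport_cyclic:
  assumes "finite (carrier G)" "odd (order G)" "davenport G \<ge> 3"
    "{2, davenport G} \<in> system_of_lengths G"
  shows "cyclic_group G" "order G = davenport G"
proof -
  interpret comm_group G using odd_order_comm_group assms by blast
  have "\<not> (\<forall>x\<in>carrier G. inv x = x)"
  proof
    assume "\<forall>x\<in>carrier G. inv x = x"
    then have "carrier G = {\<one>}" using odd_order_involution[OF assms(1,2)] by auto
    then show False using davenport_le_order[OF assms(1)] assms(3) by (simp add: order_def)
  qed
  then show "cyclic_group G" "order G = davenport G"
    using two_davenport_dichotomy[OF assms(1,3,4)] by auto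
qed

section \<open>Isomorphism invariance\<close>

lemma foldr_map_hom:
  assumes "group G" "group H" "h \<in> hom G H" "set xs \<subseteq> carrier G"
  shows "foldr (\<otimes>\<^bsub>H\<^esub>) (map h xs) \<one>\<^bsub>H\<^esub> = h (foldr (\<otimes>\<^bsub>G\<^esub>) xs \<one>\<^bsub>G\<^esub>)"
  using assms(4)
proof (induction xs)
  case Nil
  show ?case using hom_one[OF assms(3,1,2)] by simp
next
  case (Cons x xs)
  interpret G: group G by fact
  from Cons show ?case using hom_mult[OF assms(3)] G.multlist_closed[of xs] by simp
qed

lemma hom_product_one:
  assumes "group G" "group H" "h \<in> hom G H" "S \<in> product_one_sequences G"
  shows "image_mset h S \<in> product_one_sequences H"
proof -
  obtain xs where xs: "mset xs = S" "set xs \<subseteq> carrier G" "foldr (\<otimes>\<^bsub>G\<^esub>) xs \<one>\<^bsub>G\<^esub> = \<one>\<^bsub>G\<^esub>"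
    using assms(4) by (auto simp: product_one_sequences_def)
  have "mset (map h xs) \<in> product_one_sequences H"
    using xs foldr_map_hom[OF assms(1-3) xs(2)] hom_one[OF assms(3,1,2)] hom_in_carrier[OF assms(3)]
    by (intro group.product_one_sequencesI[OF assms(2)]) auto
  with xs(1) show ?thesis by simp
qed

lemma image_mset_inverse:
  assumes "\<And>x. x \<in># S \<Longrightarrow> k (h x) = x"
  shows "image_mset k (image_mset h S) = S"
proof -
  have "image_mset (k \<circ> h) S = image_mset id S" using assms by (intro image_mset_cong) auto
  then show ?thesis by (simp add: multiset.map_comp)
qed

lemma iso_atom:
  assumes "group G" "group H" "h \<in> iso G H" "A \<in> atoms G"
  shows "image_mset h A \<in> atoms H"
proof -
  interpret G: group G by fact
  define k where "k = inv_into (carrier G) h"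
  have bij: "bij_betw h (carrier G) (carrier H)" and h: "h \<in> hom G H"
    using assms(3) by (auto simp: iso_def)
  have k: "k \<in> hom H G" using G.iso_set_sym[OF assms(3)] by (auto simp: iso_def k_def)
  have kh: "image_mset k (image_mset h A) = A"
    using G.product_one_carrier[OF G.atom_product_one[OF assms(4)]] bij
    by (intro image_mset_inverse) (auto simp: k_def bij_betw_def)
  have "S = {#} \<or> T = {#}" if ST: "S \<in> product_one_sequences H" "T \<in> product_one_sequences H"
    "image_mset h A = S + T" for S T
  proof -
    have "A = image_mset k S + image_mset k T" using kh ST(3) by simp
    moreover have "image_mset k S \<in> product_one_sequences G" "image_mset k T \<in> product_one_sequences G"
      using ST hom_product_one[OF assms(2,1) k] by auto
    ultimately have "image_mset k S = {#} \<or> image_mset k T = {#}"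
      using assms(4) unfolding atoms_iff by blast
    then show ?thesis by simp
  qed
  moreover have "image_mset h A \<in> product_one_sequences H" "image_mset h A \<noteq> {#}"
    using assms(4) hom_product_one[OF assms(1,2) h] by (auto simp: atoms_iff)
  ultimately show ?thesis unfolding atoms_iff by blast
qed

text \<open>One inclusion suffices: applied to the inverse isomorphism as well, it yields
  equality.\<close>

lemma iso_lengths_subset:
  assumes "group G" "group H" "h \<in> iso G H"
  shows "lengths G S \<subseteq> lengths H (image_mset h S)"
proof
  fix l assume "l \<in> lengths G S"
  then obtain F where F: "size F = l" "set_mset F \<subseteq> atoms G" "sum_mset F = S"
    by (auto simp: lengths_def)
  have "sum_mset (image_mset (image_mset h) F) = image_mset h (sum_mset F)"
    by (induction F) auto
  moreover have "set_mset (image_mset (image_mset h) F) \<subseteq> atoms H"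
    using F(2) iso_atom[OF assms] by (auto simp: subset_iff)
  ultimately show "l \<in> lengths H (image_mset h S)"
    using F(1,3) unfolding lengths_def
    by (intro CollectI exI[of _ "image_mset (image_mset h) F"]) simp
qed

lemma iso_system_of_lengths_subset:
  assumes "group G" "group H" "G \<cong> H"
  shows "system_of_lengths G \<subseteq> system_of_lengths H"
proof
  fix L assume "L \<in> system_of_lengths G"
  then obtain S where S: "S \<in> product_one_sequences G" "L = lengths G S"
    by (auto simp: system_of_lengths_def)
  interpret G: group G by fact
  obtain h where h: "h \<in> iso G H" using assms(3) by (auto simp: is_iso_def)
  define k where "k = inv_into (carrier G) h"
  have k: "k \<in> iso H G" using G.iso_set_sym[OF h] by (simp add: k_def)
  have "image_mset k (image_mset h S) = S"
    using G.product_one_carrier[OF S(1)] h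
    by (intro image_mset_inverse) (auto simp: k_def iso_def bij_betw_def)
  then have "lengths H (image_mset h S) \<subseteq> L"
    using iso_lengths_subset[OF assms(2,1) k, of "image_mset h S"] S(2) by simp
  then have "L = lengths H (image_mset h S)"
    using iso_lengths_subset[OF assms(1,2) h, of S] S(2) by simp
  moreover have "image_mset h S \<in> product_one_sequences H"
    using hom_product_one[OF assms(1,2) _ S(1)] h by (auto simp: iso_def)
  ultimately show "L \<in> system_of_lengths H" by (auto simp: system_of_lengths_def)
qed

lemma iso_atom_sizes_subset:
  assumes "group G" "group H" "G \<cong> H"
  shows "size ` atoms G \<subseteq> size ` atoms H"
proof
  fix l assume "l \<in> size ` atoms G"
  then obtain A where A: "A \<in> atoms G" "l = size A" by blast
  obtain h where "h \<in> iso G H" using assms(3) by (auto simp: is_iso_def)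
  from iso_atom[OF assms(1,2) this A(1)] A(2) show "l \<in> size ` atoms H"
    by (metis imageI size_image_mset)
qed

lemma iso_davenport:
  assumes "group G" "group H" "G \<cong> H"
  shows "davenport G = davenport H"
proof -
  have "H \<cong> G" using group.iso_sym[OF assms(1,3)] .
  then have "size ` atoms G = size ` atoms H"
    by (intro equalityI iso_atom_sizes_subset assms)
  then show ?thesis by (simp add: davenport_def)
qed


section \<open>Dihedral groups\<close>

text \<open>
  The rotation part of a product in the dihedral group before reduction: the terms after a
  reflection enter with the opposite sign.
\<close>

fun alternating_sum :: "(int \<times> bool) list \<Rightarrow> int"
  where "alternating_sum [] = 0"
  | "alternating_sum ((i, s) # xs) = (if s then i - alternating_sum xs else i + alternating_sum xs)"

lemma foldr_dihedral:
  "foldr (\<otimes>\<^bsub>dihedral_group n\<^esub>) xs \<one>\<^bsub>dihedral_group n\<^esub>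
    = (alternating_sum xs mod int n, odd (length (filter snd xs)))"
  by (induction xs rule: alternating_sum.induct) (auto simp: dihedral_group_def mod_simps)

text \<open>For reflections the signs alternate, so the sum counts \<open>(1, True)\<close> at even
  positions minus odd ones, starting from position 0. Even positions exceed odd ones by
  \<open>of_bool (odd (length xs))\<close>; subtracting this leaves the corresponding difference for
  \<open>(0, True)\<close> with opposite sign, whence the second bound.\<close>

lemma alternating_sum_reflections:
  assumes "set xs \<subseteq> {(0, True), (1, True)}"
  shows "\<bar>alternating_sum xs\<bar> \<le> int (count (mset xs) (1, True))
    \<and> \<bar>alternating_sum xs - of_bool (odd (length xs))\<bar> \<le> int (count (mset xs) (0, True))
    \<and> (even (alternating_sum xs) \<longleftrightarrow> even (count (mset xs) (1, True)))"
  using assms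
proof (induction xs)
  case (Cons x xs)
  then consider "x = (0, True)" | "x = (1, True)" by auto
  then show ?case
  proof cases
    case 1
    with Cons show ?thesis by (cases "even (length xs)") auto
  next
    case 2
    with Cons show ?thesis by (cases "even (length xs)") auto
  qed
qed simp

text \<open>Each \<open>(1, False)\<close> contributes 1 or -1, according to the number of
  reflections before it; \<open>(0, True)\<close> contributes nothing but flips later signs.\<close>

lemma alternating_sum_one_reflection:
  assumes "set xs \<subseteq> {(1, False), (0, True)}"
  shows "\<bar>alternating_sum xs\<bar> \<le> int (count (mset xs) (1, False))
    \<and> (even (alternating_sum xs) \<longleftrightarrow> even (count (mset xs) (1, False)))
    \<and> ((0, True) \<notin> set xs \<longrightarrow> alternating_sum xs = int (count (mset xs) (1, False)))"
  using assms
proof (induction xs)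
  case (Cons x xs)
  then consider "x = (1, False)" | "x = (0, True)" by auto
  then show ?case
  proof cases
    case 1
    with Cons show ?thesis by auto
  next
    case 2
    with Cons show ?thesis by auto
  qed
qed simp

lemma replicate_mset_add: "replicate_mset (m + k) x = replicate_mset m x + replicate_mset k x"
  by (induction m) auto

lemma size_eq_count_add:
  assumes "set_mset W \<subseteq> {x, y}" "x \<noteq> y"
  shows "size W = count W x + count W y"
  using assms(1) by (induction W) (use assms(2) in auto)

lemma int_dvd_odd_le:
  fixes z :: int
  assumes "int n dvd z" "odd z" "\<bar>z\<bar> \<le> int k"
  shows "n \<le> k"
proof -
  have "z \<noteq> 0" using assms(2) by auto
  then have "int n \<le> \<bar>z\<bar>" using assms(1) by (intro zdvd_imp_le) auto
  with assms(3) show ?thesis by simp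
qed

locale odd_dihedral =
  fixes n :: nat
  assumes n: "n \<ge> 3" "odd n"
begin

sublocale group "dihedral_group n"
  using n by (intro group_dihedral_group) simp

abbreviation "rot \<equiv> (1 :: int, False)"
abbreviation "refl0 \<equiv> (0 :: int, True)"
abbreviation "refl1 \<equiv> (1 :: int, True)"

lemma finite_carrier: "finite (carrier (dihedral_group n))"
  using n by (simp add: dihedral_group_def carrier_integer_mod_group)

lemma order: "order (dihedral_group n) = 2 * n"
  using n by (intro order_dihedral_group) simp

lemma generators_closed:
  "rot \<in> carrier (dihedral_group n)" "refl0 \<in> carrier (dihedral_group n)"
  "refl1 \<in> carrier (dihedral_group n)"
  using n by (auto simp: dihedral_group_def carrier_integer_mod_group)

lemma inv_reflections:
  "inv\<^bsub>dihedral_group n\<^esub> refl0 = refl0" "inv\<^bsub>dihedral_group n\<^esub> refl1 = refl1"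
proof -
  have "x \<otimes>\<^bsub>dihedral_group n\<^esub> x = \<one>\<^bsub>dihedral_group n\<^esub>" if "x = refl0 \<or> x = refl1" for x
    using that by (auto simp: dihedral_group_def)
  then show "inv\<^bsub>dihedral_group n\<^esub> refl0 = refl0" "inv\<^bsub>dihedral_group n\<^esub> refl1 = refl1"
    using generators_closed by (simp_all add: inv_equality)
qed

lemma product_one_dihedralE:
  assumes "W \<in> product_one_sequences (dihedral_group n)"
  obtains xs where "mset xs = W" "int n dvd alternating_sum xs" "even (length (filter snd xs))"
proof -
  obtain xs where "mset xs = W"
    "foldr (\<otimes>\<^bsub>dihedral_group n\<^esub>) xs \<one>\<^bsub>dihedral_group n\<^esub> = \<one>\<^bsub>dihedral_group n\<^esub>"
    using assms by (rule product_one_sequencesE)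
  with that show thesis unfolding foldr_dihedral
    by (auto simp: dihedral_group_def)
qed

text \<open>With an odd number of \<open>refl1\<close>, the signed sum is an odd multiple of
  \<open>n\<close>. Its absolute value is at least \<open>n\<close> and is bounded by both
  multiplicities.\<close>

lemma reflections_product_one:
  assumes "W \<in> product_one_sequences (dihedral_group n)" "set_mset W \<subseteq> {refl0, refl1}"
  shows "even (size W)"
    and "even (count W refl1) \<or> n \<le> count W refl1 \<and> n \<le> count W refl0"
proof -
  obtain xs where xs: "mset xs = W" "int n dvd alternating_sum xs" "even (length (filter snd xs))"
    using assms(1) by (rule product_one_dihedralE)
  have set: "set xs \<subseteq> {refl0, refl1}" using assms(2) xs(1) by auto
  then have "filter snd xs = xs" by (auto simp: filter_id_conv)
  with xs(3) have len: "even (length xs)" by simp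
  with xs(1) show "even (size W)" by auto
  show "even (count W refl1) \<or> n \<le> count W refl1 \<and> n \<le> count W refl0"
    using alternating_sum_reflections[OF set] len xs(1) int_dvd_odd_le[OF xs(2)] by auto
qed

lemma rotation_product_one:
  assumes "W \<in> product_one_sequences (dihedral_group n)" "set_mset W \<subseteq> {rot, refl0}"
  shows "even (count W refl0)"
    and "odd (count W rot) \<Longrightarrow> n \<le> count W rot"
    and "count W refl0 = 0 \<Longrightarrow> n dvd count W rot"
proof -
  obtain xs where xs: "mset xs = W" "int n dvd alternating_sum xs" "even (length (filter snd xs))"
    using assms(1) by (rule product_one_dihedralE)
  have set: "set xs \<subseteq> {rot, refl0}" using assms(2) xs(1) by auto
  then have "length (filter snd xs) = count (mset xs) refl0"
    by (induction xs) auto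
  with xs(1,3) show "even (count W refl0)" by simp
  show "n \<le> count W rot" if "odd (count W rot)"
    using alternating_sum_one_reflection[OF set] that xs(1) int_dvd_odd_le[OF xs(2)] by auto
  show "n dvd count W rot" if "count W refl0 = 0"
  proof -
    have "refl0 \<notin> set xs" using that xs(1) by (metis not_in_iff set_mset_mset)
    then show ?thesis using alternating_sum_one_reflection[OF set] xs(1,2) by simp
  qed
qed

definition reflection_atom :: "(int \<times> bool) multiset"
  where "reflection_atom = replicate_mset n refl1 + replicate_mset n refl0"

text \<open>Alternating the two reflections gives (ab)b = a in each step, so the product is
  a^n.\<close>

lemma reflection_atom_product_one: "reflection_atom \<in> product_one_sequences (dihedral_group n)"
proof -
  define xs where "xs m = concat (replicate m [refl1, refl0])" for m
  have "mset (xs m) = replicate_mset m refl1 + replicate_mset m refl0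
    \<and> alternating_sum (xs m) = int m \<and> even (length (filter snd (xs m)))
    \<and> set (xs m) \<subseteq> {refl0, refl1}" for m
    by (induction m) (auto simp: xs_def)
  from this[of n] have "mset (xs n) = reflection_atom" "set (xs n) \<subseteq> {refl0, refl1}"
    "alternating_sum (xs n) = int n" "even (length (filter snd (xs n)))"
    by (simp_all add: reflection_atom_def)
  moreover from this(2-4) have "mset (xs n) \<in> product_one_sequences (dihedral_group n)"
    using generators_closed
    by (intro product_one_sequencesI) (auto simp: foldr_dihedral, auto simp: dihedral_group_def)
  ultimately show ?thesis by simp
qed

lemma reflection_atom_subseteq:
  assumes "n \<le> count W refl1" "n \<le> count W refl0"
  shows "reflection_atom \<subseteq># W"
  using assms by (intro mset_subset_eqI) (auto simp: reflection_atom_def)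

lemma size_reflection_atom: "size reflection_atom = 2 * n"
  by (simp add: reflection_atom_def)

text \<open>As \<open>n\<close> is odd, one of two factors contains an odd number of
  \<open>refl1\<close>. It then contains \<open>n\<close> copies of either reflection, that is,
  everything.\<close>

lemma reflection_atom_atom: "reflection_atom \<in> atoms (dihedral_group n)"
proof -
  have *: "T = {#}" if ST: "S \<in> product_one_sequences (dihedral_group n)"
    "reflection_atom = S + T" "odd (count S refl1)" for S T
  proof -
    have "set_mset (S + T) \<subseteq> {refl0, refl1}"
      unfolding ST(2)[symmetric] by (auto simp: reflection_atom_def)
    then have "set_mset S \<subseteq> {refl0, refl1}" by simp
    from reflections_product_one(2)[OF ST(1) this] ST(3)
    have "S + T \<subseteq># S" using reflection_atom_subseteq[of S] ST(2) by simp
    then show ?thesis using size_mset_mono[of "S + T" S] by simp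
  qed
  have "S = {#} \<or> T = {#}" if ST: "S \<in> product_one_sequences (dihedral_group n)"
    "T \<in> product_one_sequences (dihedral_group n)" "reflection_atom = S + T" for S T
  proof -
    have "count S refl1 + count T refl1 = n"
      using arg_cong[OF ST(3), of "\<lambda>M. count M refl1"] by (simp add: reflection_atom_def)
    then have "odd (count S refl1) \<or> odd (count T refl1)" using n(2) by auto
    moreover have "reflection_atom = T + S" using ST(3) by (simp add: union_commute)
    ultimately show ?thesis using *[OF ST(1,3)] *[OF ST(2), of S] by blast
  qed
  moreover have "reflection_atom \<noteq> {#}" using n by (auto simp: reflection_atom_def)
  ultimately show ?thesis
    using reflection_atom_product_one unfolding atoms_iff by blast
qed

lemma davenport_dihedral: "davenport (dihedral_group n) = 2 * n"
  using size_atom_le_davenport[OF finite_carrier reflection_atom_atom]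
    davenport_le_order[OF finite_carrier] order size_reflection_atom by simp

lemma inv_reflection_atom: "inv_seq reflection_atom = reflection_atom"
  by (simp add: reflection_atom_def inv_reflections)

lemma even_reflections_product_one:
  assumes "x = refl0 \<or> x = refl1"
  shows "replicate_mset (2 * i) x \<in> product_one_sequences (dihedral_group n)"
proof (induction i)
  case 0
  show ?case by (simp add: empty_product_one)
next
  case (Suc i)
  have "{#x, x#} \<in> product_one_sequences (dihedral_group n)"
    using assms product_one_pair[of x] generators_closed inv_reflections by auto
  from product_one_add[OF this Suc] show ?case by simp
qed

text \<open>Such a sequence splits into pairs of equal reflections, so an atom of this kind is a
  single pair.\<close>

lemma even_reflections_atom:
  assumes W: "W \<in> atoms (dihedral_group n)" "set_mset W \<subseteq> {refl0, refl1}"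
    and even: "even (count W refl0)" "even (count W refl1)"
  shows "size W = 2"
proof -
  obtain i j where ij: "count W refl0 = 2 * i" "count W refl1 = 2 * j" using even by (auto elim!: evenE)
  have Weq: "W = replicate_mset (2 * i) refl0 + replicate_mset (2 * j) refl1"
  proof (rule multiset_eqI)
    fix x show "count W x = count (replicate_mset (2 * i) refl0 + replicate_mset (2 * j) refl1) x"
      using ij W(2) by (cases "x \<in># W") (auto simp: not_in_iff)
  qed
  define k x where "k = (if i = 0 then j else i)" and "x = (if i = 0 then refl1 else refl0)"
  have "W \<noteq> {#}" using W(1) empty_notin_atoms by metis
  show ?thesis
  proof (cases "i = 0 \<or> j = 0")
    case False
    have "replicate_mset (2 * i) refl0 = {#} \<or> replicate_mset (2 * j) refl1 = {#}"
      using W(1) Weq even_reflections_product_one unfolding atoms_iff by blast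
    with False show ?thesis by simp
  next
    case True
    then have Wk: "W = replicate_mset (2 * k) x" using Weq by (auto simp: k_def x_def)
    with \<open>W \<noteq> {#}\<close> have "k > 0" by (auto intro: Nat.gr0I)
    then have "2 * k = 2 * 1 + 2 * (k - 1)" by simp
    then have "W = replicate_mset (2 * 1) x + replicate_mset (2 * (k - 1)) x"
      unfolding Wk by (metis replicate_mset_add)
    moreover have "x = refl0 \<or> x = refl1" by (simp add: x_def)
    ultimately have "replicate_mset (2 * 1) x = {#} \<or> replicate_mset (2 * (k - 1)) x = {#}"
      using W(1) even_reflections_product_one unfolding atoms_iff by blast
    then have "k = 1" using \<open>k > 0\<close> by auto
    with Wk show ?thesis by simp
  qed
qed

text \<open>An atom inside two copies of \<open>reflection_atom\<close> either contains an odd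
  number of \<open>refl1\<close>, hence all of \<open>reflection_atom\<close>, and equals it by the
  length bound, or both its multiplicities are even and it is a pair.\<close>

lemma two_davenport_dihedral:
  "{2, davenport (dihedral_group n)} \<in> system_of_lengths (dihedral_group n)"
proof -
  have "lengths (dihedral_group n) (reflection_atom + inv_seq reflection_atom)
    = {2, size reflection_atom}"
  proof (rule lengths_atom_inverse)
    fix W assume W: "W \<in> atoms (dihedral_group n)" "W \<subseteq># reflection_atom + inv_seq reflection_atom"
    have "set_mset W \<subseteq> set_mset (reflection_atom + reflection_atom)"
      using set_mset_mono[OF W(2)] unfolding inv_reflection_atom .
    also have "set_mset (reflection_atom + reflection_atom) = {refl0, refl1}"
      using n by (auto simp: reflection_atom_def)
    finally have set: "set_mset W \<subseteq> {refl0, refl1}" .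
    note po = reflections_product_one[OF atom_product_one[OF W(1)] set]
    show "W = reflection_atom \<or> W = inv_seq reflection_atom \<or> size W = 2"
    proof (cases "even (count W refl1)")
      case True
      have "size W = count W refl0 + count W refl1"
        using set by (intro size_eq_count_add) auto
      with True po(1) have "even (count W refl0)" by simp
      with even_reflections_atom[OF W(1) set] True show ?thesis by simp
    next
      case False
      with po(2) have "reflection_atom \<subseteq># W" using reflection_atom_subseteq by simp
      then obtain R where R: "W = reflection_atom + R" by (metis subset_mset.add_diff_inverse)
      have "size W \<le> 2 * n"
        using size_atom_le_davenport[OF finite_carrier W(1)] davenport_dihedral by simp
      with R size_reflection_atom have "R = {#}" by simp
      with R show ?thesis by simp
    qed
  qed (use reflection_atom_atom size_reflection_atom n in auto)
  then have "lengths (dihedral_group n) (reflection_atom + reflection_atom)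
    = {2, davenport (dihedral_group n)}"
    by (simp add: inv_reflection_atom size_reflection_atom davenport_dihedral)
  then show ?thesis
    using product_one_add[OF reflection_atom_product_one reflection_atom_product_one]
    unfolding system_of_lengths_def by (metis image_eqI)
qed

section \<open>A set of lengths of the dihedral group that properly contains {2, 2n}\<close>

lemma rotations_atom: "replicate_mset n rot \<in> atoms (dihedral_group n)"
proof -
  have "alternating_sum (replicate m rot) = int m" for m by (induction m) auto
  then have "mset (replicate n rot) \<in> product_one_sequences (dihedral_group n)"
    using generators_closed
    by (intro product_one_sequencesI) (auto simp: foldr_dihedral simp del: foldr_replicate, auto simp: dihedral_group_def)
  moreover have "S = {#} \<or> T = {#}" if ST: "S \<in> product_one_sequences (dihedral_group n)"
    "T \<in> product_one_sequences (dihedral_group n)" "replicate_mset n rot = S + T" for S T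
  proof -
    have "S \<subseteq># replicate_mset n rot" using ST(3) by simp
    then obtain i where i: "S = replicate_mset i rot" "i \<le> n"
      by (metis msubseteq_replicate_msetE)
    have "n dvd i" using rotation_product_one(3)[OF ST(1)] i by (auto split: if_splits)
    with i(2) have "i = 0 \<or> i = n" by (auto dest: dvd_imp_le)
    with i(1) ST(3) show ?thesis by auto
  qed
  ultimately show ?thesis using n by (auto simp: atoms_iff)
qed

text \<open>In terms of the generators this is a^(2n-2) b^2, of length 2n = D(G). It contains the
  atom a^n although it is an atom itself: the complement a^(n-2) b^2 is not product-one. Together
  with the inverse sequence, however, a^n does split off.\<close>

definition mixed_atom :: "(int \<times> bool) multiset"
  where "mixed_atom = replicate_mset (2 * n - 2) rot + {#refl0, refl0#}"

lemma mixed_atom_atom: "mixed_atom \<in> atoms (dihedral_group n)"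
proof -
  \<comment> \<open>The ordering a^(n-1) b a^(n-1) b has product one because b inverts
    a^(n-1).\<close>
  define xs where "xs = replicate (n - 1) rot @ [refl0] @ replicate (n - 1) rot @ [refl0]"
  have alt: "alternating_sum (replicate m rot @ ys) = int m + alternating_sum ys" for m ys
    by (induction m) auto
  have "alternating_sum xs = 0" by (simp add: xs_def alt)
  moreover have "filter snd xs = [refl0, refl0]" by (simp add: xs_def)
  moreover have "set xs \<subseteq> carrier (dihedral_group n)"
    using generators_closed by (auto simp: xs_def)
  ultimately have "mset xs \<in> product_one_sequences (dihedral_group n)"
    by (intro product_one_sequencesI) (simp_all add: foldr_dihedral, simp add: dihedral_group_def)
  moreover have "2 * n - 2 = (n - 1) + (n - 1)" by simp
  then have "mset xs = mixed_atom"
    unfolding mixed_atom_def xs_def by (simp add: replicate_mset_add)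
  ultimately have po: "mixed_atom \<in> product_one_sequences (dihedral_group n)" by simp
  have *: "T = {#}" if ST: "S \<in> product_one_sequences (dihedral_group n)"
    "T \<in> product_one_sequences (dihedral_group n)" "mixed_atom = S + T" "count T refl0 = 0" for S T
  proof -
    have "set_mset (S + T) \<subseteq> {rot, refl0}"
      unfolding ST(3)[symmetric] by (auto simp: mixed_atom_def)
    then have set: "set_mset S \<subseteq> {rot, refl0}" "set_mset T \<subseteq> {rot, refl0}" by simp_all
    have c: "count S rot + count T rot = 2 * n - 2"
      using arg_cong[OF ST(3), of "\<lambda>M. count M rot"] by (simp add: mixed_atom_def)
    have "n dvd count T rot" using rotation_product_one(3)[OF ST(2) set(2) ST(4)] .
    then obtain q where q: "count T rot = n * q" by (elim dvdE)
    \<comment> \<open>Here \<open>q = 1\<close> would leave \<open>n - 2\<close> rotations in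
      \<open>S\<close>, an odd number below \<open>n\<close>, and \<open>q \<ge> 2\<close> exceeds
      the 2n - 2 rotations available.\<close>
    have "q = 0"
    proof (rule ccontr)
      assume "q \<noteq> 0"
      moreover have "n * q < n * 2" using c q n by linarith
      then have "q < 2" by simp
      ultimately have "q = 1" by simp
      with c q have "count S rot = n - 2" by simp
      with rotation_product_one(2)[OF ST(1) set(1)] n show False by simp
    qed
    then have "rot \<notin># T" "refl0 \<notin># T" using q ST(4) by (simp_all add: not_in_iff)
    with set(2) have "set_mset T = {}" by auto
    then show ?thesis by simp
  qed
  have "S = {#} \<or> T = {#}" if ST: "S \<in> product_one_sequences (dihedral_group n)"
    "T \<in> product_one_sequences (dihedral_group n)" "mixed_atom = S + T" for S T
  proof -
    have "set_mset (S + T) \<subseteq> {rot, refl0}"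
      unfolding ST(3)[symmetric] by (auto simp: mixed_atom_def)
    then have "even (count S refl0)" "even (count T refl0)"
      using rotation_product_one(1) ST(1,2) by simp_all
    moreover have "count S refl0 + count T refl0 = 2"
      using arg_cong[OF ST(3), of "\<lambda>M. count M refl0"] by (simp add: mixed_atom_def)
    ultimately have "count S refl0 = 0 \<or> count T refl0 = 0" by presburger
    moreover have "mixed_atom = T + S" using ST(3) by (simp add: union_commute)
    ultimately show ?thesis using *[OF ST] *[OF ST(2,1)] by blast
  qed
  with po show ?thesis by (auto simp: atoms_iff mixed_atom_def)
qed

lemma two_davenport_dihedral_proper:
  "\<exists>L\<in>system_of_lengths (dihedral_group n). {2, davenport (dihedral_group n)} \<subset> L"
proof -
  define L where "L = lengths (dihedral_group n) (mixed_atom + inv_seq mixed_atom)"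
  have "size mixed_atom = 2 * n" using n by (simp add: mixed_atom_def)
  then have sub: "{2, davenport (dihedral_group n)} \<subseteq> L"
    unfolding L_def using two_davenport_in_lengths[OF mixed_atom_atom] n davenport_dihedral by simp
  let ?r = "replicate_mset n rot" and ?s = "replicate_mset (n - 2) rot"
  have one: "\<one>\<^bsub>dihedral_group n\<^esub> = (0, False)" by (simp add: dihedral_group_def)
  have pair: "{#refl0, refl0#} \<in> atoms (dihedral_group n)"
    using atom_pair[OF generators_closed(2)] inv_reflections one by simp
  have "\<one>\<^bsub>dihedral_group n\<^esub> \<notin># ?s" "set_mset ?s \<subseteq> carrier (dihedral_group n)"
    using generators_closed one by auto
  then have "size ?s \<in> lengths (dihedral_group n) (?s + inv_seq ?s)"
    by (intro pairs_in_lengths)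
  note s = this
  \<comment> \<open>The atoms are a^n and its inverse, n - 2 pairs of a rotation and its inverse,
    and two copies of the pair b, b.\<close>
  have "1 + 1 + size ?s + 1 + 1 = n + 2" using n by simp
  from lengths_add[OF lengths_add[OF lengths_add[OF lengths_add[OF lengths_atom[OF rotations_atom]
    lengths_atom[OF atom_inv_seq[OF rotations_atom]]] s] lengths_atom[OF pair]] lengths_atom[OF pair]]
  have "n + 2 \<in> lengths (dihedral_group n)
    (?r + inv_seq ?r + (?s + inv_seq ?s) + {#refl0, refl0#} + {#refl0, refl0#})"
    unfolding \<open>1 + 1 + size ?s + 1 + 1 = n + 2\<close> .
  moreover have "mixed_atom = ?r + ?s + {#refl0, refl0#}"
    unfolding mixed_atom_def replicate_mset_add[symmetric] using n by (simp add: mult_2)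
  then have "mixed_atom + inv_seq mixed_atom
    = ?r + inv_seq ?r + (?s + inv_seq ?s) + {#refl0, refl0#} + {#refl0, refl0#}"
    by (simp add: inv_reflections ac_simps)
  ultimately have "n + 2 \<in> L" by (simp add: L_def)
  \<comment> \<open>Since \<open>n \<ge> 3\<close>, this length lies strictly between 2 and
    2n.\<close>
  moreover have "n + 2 \<notin> {2, davenport (dihedral_group n)}" using n davenport_dihedral by simp
  ultimately have "{2, davenport (dihedral_group n)} \<subset> L" using sub by blast
  moreover have "L \<in> system_of_lengths (dihedral_group n)"
    unfolding L_def system_of_lengths_def using mixed_atom_atom
    by (intro imageI product_one_add product_one_inv_seq atom_product_one)
  ultimately show ?thesis by blast
qed

end

section \<open>Cyclic groups\<close>

text \<open>A nontrivial \<open>x\<close> is not an involution, so \<open>{#x, x#}\<close> has no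
  nonempty product-one subsequence and D(G) exceeds 2.\<close>

lemma (in group) odd_order_davenport_ge_3:
  assumes "finite (carrier G)" "order G \<ge> 3" "odd (order G)"
  shows "davenport G \<ge> 3"
proof -
  obtain x where x: "x \<in> carrier G" "x \<noteq> \<one>"
  proof (cases "carrier G = {\<one>}")
    case True
    then have "order G = 1" by (simp add: order_def)
    with assms(2) show thesis by simp
  next
    case False
    with that one_closed show thesis by blast
  qed
  have no_one: "W \<subseteq># {#x, x#} \<Longrightarrow> W \<in> product_one_sequences G \<Longrightarrow> W = {#}" for W
  proof -
    assume W: "W \<subseteq># {#x, x#}" "W \<in> product_one_sequences G"
    have sub: "set_mset W \<subseteq> {x}" using set_mset_mono[OF W(1)] by simp
    have "size W \<le> 2" using size_mset_mono[OF W(1)] by simp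
    moreover have "size W \<noteq> 1"
    proof
      assume "size W = 1"
      then obtain y where "W = {#y#}" by (metis size_1_singleton_mset)
      with W(2) sub x show False by (simp add: product_one_single)
    qed
    moreover have "size W \<noteq> 2"
    proof
      assume "size W = 2"
      then obtain y where "y \<in> carrier G" "W = {#y, inv y#}"
        using product_one_size_2[OF W(2)] by blast
      with sub have "inv x = x" by auto
      with odd_order_involution[OF assms(1,3) x(1)] x(2) show False by simp
    qed
    ultimately have "size W = 0" by linarith
    then show "W = {#}" by simp
  qed
  have "size {#x, x#} < davenport G"
    using x no_one by (intro product_one_free_size[OF assms(1)]) auto
  then show ?thesis by simp
qed

lemma cyclic_integer_mod_group:
  assumes "m \<ge> 2"
  shows "cyclic_group (integer_mod_group m)"
proof -
  interpret Z: group "integer_mod_group m" by simp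
  have "carrier (integer_mod_group m) = range (\<lambda>k::int. 1 [^]\<^bsub>integer_mod_group m\<^esub> k)"
  proof
    show "carrier (integer_mod_group m) \<subseteq> range (\<lambda>k::int. 1 [^]\<^bsub>integer_mod_group m\<^esub> k)"
    proof
      fix z assume "z \<in> carrier (integer_mod_group m)"
      then have "z = 1 [^]\<^bsub>integer_mod_group m\<^esub> z"
        using assms by (simp add: int_pow_integer_mod_group carrier_integer_mod_group)
      then show "z \<in> range (\<lambda>k::int. 1 [^]\<^bsub>integer_mod_group m\<^esub> k)" by blast
    qed
    show "range (\<lambda>k::int. 1 [^]\<^bsub>integer_mod_group m\<^esub> k) \<subseteq> carrier (integer_mod_group m)"
      using assms by (auto simp: int_pow_integer_mod_group carrier_integer_mod_group)
  qed
  moreover have "1 \<in> carrier (integer_mod_group m)" using assms by simp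
  ultimately show ?thesis unfolding Z.cyclic_group by blast
qed

lemma (in group) cyclic_iso_integer_mod_group:
  assumes fin: "finite (carrier G)" and cyc: "cyclic_group G"
  shows "G \<cong> integer_mod_group (order G)"
proof -
  obtain g where g: "g \<in> carrier G" "carrier G = range (\<lambda>k::int. g [^] k)"
    using cyc by (auto simp: cyclic_group)
  define m where "m = order G"
  have "m > 0" using fin by (simp add: m_def order_gt_0_iff_finite)
  have "generate G {g} = carrier G" using g generate_pow[OF g(1)] by auto
  then have ord: "ord g = m" using generate_pow_card[OF g(1)] by (simp add: order_def m_def)
  have eq: "g [^] k = g [^] l \<longleftrightarrow> int m dvd k - l" for k l :: int
    using int_pow_eq[OF g(1), of k l] ord by (simp add: mod_eq_dvd_iff dvd_diff_commute)
  define f where "f k = g [^] k" for k :: int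
  have "f \<in> hom (integer_mod_group m) G"
  proof (rule homI)
    fix k l
    have "g [^] ((k + l) mod int m) = g [^] (k + l)"
      unfolding eq by (metis dvd_minus_mod dvd_diff_commute)
    then show "f (k \<otimes>\<^bsub>integer_mod_group m\<^esub> l) = f k \<otimes> f l"
      using g(1) by (simp add: f_def int_pow_mult)
  qed (use g in \<open>auto simp: f_def\<close>)
  moreover have "bij_betw f (carrier (integer_mod_group m)) (carrier G)"
  proof -
    have "inj_on f (carrier (integer_mod_group m))"
    proof (rule inj_onI)
      fix k l
      assume kl: "k \<in> carrier (integer_mod_group m)" "l \<in> carrier (integer_mod_group m)" "f k = f l"
      then have "k mod int m = l mod int m" unfolding f_def eq by (simp add: mod_eq_dvd_iff)
      with kl(1,2) \<open>m > 0\<close> show "k = l" by (simp add: carrier_integer_mod_group)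
    qed
    moreover have "card (f ` carrier (integer_mod_group m)) = card (carrier G)"
      using card_image[OF calculation] \<open>m > 0\<close>
      by (simp add: carrier_integer_mod_group) (simp add: m_def order_def)
    moreover have "f ` carrier (integer_mod_group m) \<subseteq> carrier G" using g by (auto simp: f_def)
    ultimately show ?thesis
      using card_subset_eq[OF fin] by (auto simp: bij_betw_def)
  qed
  ultimately have "integer_mod_group m \<cong> G" by (auto simp: is_iso_def iso_def)
  then show ?thesis unfolding m_def by (rule group.iso_sym[OF group_integer_mod_group])
qed

theorem theorem4p4:
  fixes G :: "'a monoid" and G' :: "'b monoid" and n :: nat
  assumes "group G" and "finite (carrier G)"
    and "group G'" and "finite (carrier G')"
    and "n \<ge> 3" and "odd n"
  shows "(order G \<ge> 3 \<and> odd (order G) \<longrightarrow>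
            ({2, davenport G} \<in> system_of_lengths G \<longleftrightarrow> G \<cong> integer_mod_group (davenport G)))
       \<and> (order G \<ge> 3 \<and> odd (order G) \<and> cyclic_group G' \<and>
            system_of_lengths G' = system_of_lengths G \<longrightarrow> G' \<cong> G)
       \<and> (G \<cong> dihedral_group n \<longrightarrow>
            {2, davenport G} \<in> system_of_lengths G \<and>
            (\<exists>L \<in> system_of_lengths G. {2, davenport G} \<subset> L))
       \<and> (comm_group G' \<longrightarrow> system_of_lengths G' \<noteq> system_of_lengths (dihedral_group n))"
proof (intro conjI impI)
  interpret G: group G by fact
  interpret G': group G' by fact
  interpret D: odd_dihedral n using assms(5,6) by unfold_locales
  note fin = assms(2) and fin' = assms(4)
  {
    assume odd: "order G \<ge> 3 \<and> odd (order G)"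
    then have D: "davenport G \<ge> 3" using G.odd_order_davenport_ge_3 fin by blast
    show "{2, davenport G} \<in> system_of_lengths G \<longleftrightarrow> G \<cong> integer_mod_group (davenport G)"
    proof
      assume "{2, davenport G} \<in> system_of_lengths G"
      with odd D have "cyclic_group G" "order G = davenport G"
        using G.odd_two_davenport_cyclic[OF fin] by auto
      with G.cyclic_iso_integer_mod_group[OF fin] show "G \<cong> integer_mod_group (davenport G)" by simp
    next
      assume "G \<cong> integer_mod_group (davenport G)"
      then have "cyclic_group G"
        using isomorphic_group_cyclicity[OF _ assms(1) group_integer_mod_group]
          cyclic_integer_mod_group[of "davenport G"] D by simp
      with odd show "{2, davenport G} \<in> system_of_lengths G"
        using G.cyclic_two_davenport(2)[OF fin] by blast
    qed
  }
  {
    assume *: "order G \<ge> 3 \<and> odd (order G) \<and> cyclic_group G'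
      \<and> system_of_lengths G' = system_of_lengths G"
    then have D: "davenport G \<ge> 3" using G.odd_order_davenport_ge_3 fin by blast
    \<comment> \<open>Both groups turn out to be cyclic of order D(G): the cyclic group has {2,
      D(G)} in its system, equality of the systems hands this set to \<open>G\<close>, and the
      odd-order characterization applies.\<close>
    have eqD: "davenport G = davenport G'"
      using davenport_eq_of_system_eq[OF assms(1,2,3,4) _ D] * by simp
    then have "order G' \<ge> 3" using G'.davenport_le_order[OF fin'] D by simp
    with * have G': "davenport G' = order G'" "{2, davenport G'} \<in> system_of_lengths G'"
      using G'.cyclic_two_davenport[OF fin'] by auto
    with * eqD D have G: "cyclic_group G" "order G = davenport G"
      using G.odd_two_davenport_cyclic[OF fin] by auto
    have "G \<cong> integer_mod_group (order G')"
      using G.cyclic_iso_integer_mod_group[OF fin] G G'(1) eqD by simp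
    then have "integer_mod_group (order G') \<cong> G" by (rule G.iso_sym)
    moreover have "G' \<cong> integer_mod_group (order G')"
      using G'.cyclic_iso_integer_mod_group[OF fin'] * by blast
    ultimately show "G' \<cong> G" by (metis iso_trans)
  }
  {
    assume iso: "G \<cong> dihedral_group n"
    then have "dihedral_group n \<cong> G" by (rule G.iso_sym)
    then have "system_of_lengths (dihedral_group n) \<subseteq> system_of_lengths G"
      by (intro iso_system_of_lengths_subset assms(1) D.is_group)
    moreover have "davenport G = davenport (dihedral_group n)"
      using iso by (intro iso_davenport assms(1) D.is_group)
    ultimately show "{2, davenport G} \<in> system_of_lengths G"
      and "\<exists>L\<in>system_of_lengths G. {2, davenport G} \<subset> L"
      using D.two_davenport_dihedral D.two_davenport_dihedral_proper by auto
  }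
  {
    assume "comm_group G'"
    then interpret C: comm_group G' .
    show "system_of_lengths G' \<noteq> system_of_lengths (dihedral_group n)"
    proof
      assume eq: "system_of_lengths G' = system_of_lengths (dihedral_group n)"
      have D: "davenport (dihedral_group n) \<ge> 3" using D.davenport_dihedral assms(5) by simp
      have eqD: "davenport (dihedral_group n) = davenport G'"
        using D.finite_carrier D.is_group eq D assms(3,4)
        by (intro davenport_eq_of_system_eq) auto
      \<comment> \<open>The dihedral system contains both {2, 2n} and a proper superset; an abelian
        group with the same Davenport constant cannot have both.\<close>
      obtain L where L: "L \<in> system_of_lengths G'" "{2, davenport G'} \<subset> L"
        using D.two_davenport_dihedral_proper eq eqD by auto
      have "{2, davenport G'} \<in> system_of_lengths G'"
        using D.two_davenport_dihedral eq eqD by simp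
      then have "L = {2, davenport G'}"
        using L D eqD psubset_imp_subset[OF L(2)]
        by (intro C.two_davenport_lengths_unique[OF fin']) simp_all
      with L(2) show False by simp
    qed
  }
qed

end
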